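(* Let $(\mathfrak k,\mathfrak g,\pi,\cdot)$ be a crossed module of Leibniz algebras over a field $\Bbbk$. Any representations $(M_i,\ast_i,(\delta_0)_i)$, $1\le i\le r$, of $(\mathfrak k,\mathfrak g,\pi,\cdot)$ form a braided system in the category of $\Bbbk$-vector spaces, with the braidings on $M_i\otimes M_j$ given by $$\sigma(m\otimes n)=n\otimes m+n_{(0)}\otimes \bigl(m\ast_i\pi(n_{(1)})\bigr),$$ where $(\delta_0)_j(n)=n_{(0)}\otimes n_{(1)}\in M_j\otimes\mathfrak k$ (Sweedler's notation, summation omitted).
   Context: A (right) Leibniz algebra is a vector space $\mathfrak k$ with a bilinear bracket satisfying $[v,[w,u]]=[[v,w],u]-[[v,u],w]$. An action (representation) of $\mathfrak g$ on a vector space $M$ is a bilinear map $M\times\mathfrak g\to M$, $(m,g)\mapsto m\ast g$, with $m\ast[g,g']=(m\ast g)\ast g'-(m\ast g')\ast g$. A derivation of $\mathfrak k$ is a linear map $f$ with $f([k,k'])=[k,f(k')]+[f(k),k']$. A crossed module of Leibniz algebras $(\mathfrak k,\mathfrak g,\pi,\cdot)$ is a Leibniz algebra morphism $\pi\colon\mathfrak k\to\mathfrak g$ together with an action $\cdot$ of $\mathfrak g$ on $\mathfrak k$ by derivations such that $k\cdot\pi(k')=[k,k']_{\mathfrak k}$ and $\pi(k\cdot g)=[\pi(k),g]_{\mathfrak g}$. A representation of $(\mathfrak k,\mathfrak g,\pi,\cdot)$ is a vector space $M$ with a $\mathfrak g$-action $\ast$ and a linear map $\delta_0\colon M\to M\otimes\mathfrak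 k$ such that $(\delta_0\otimes\mathrm{Id}_{\mathfrak k})\circ\delta_0=0$ and $\delta_0(m\ast g)=\delta_0(m)\ast g$, where $(m\otimes k)\ast g=m\otimes k\cdot g+m\ast g\otimes k$. A braided system is a family $V_1,\dots,V_r$ with morphisms $\sigma_{i,j}\colon V_i\otimes V_j\to V_j\otimes V_i$, $i\le j$, satisfying for all $i\le j\le k$: $(\sigma_{j,k}\otimes V_i)\circ(V_j\otimes\sigma_{i,k})\circ(\sigma_{i,j}\otimes V_k)=(V_k\otimes\sigma_{i,j})\circ(\sigma_{i,k}\otimes V_j)\circ(V_i\otimes\sigma_{j,k})$ (an object's name also denotes its identity morphism). Braidings need not be invertible. *)

theory Defs
  imports "HOL-Algebra.Module" "HOL-Algebra.QuotRing"
begin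

section \<open>Linear and bilinear maps\<close>

definition linear_maps ::
  "('k, 'r) ring_scheme \<Rightarrow> ('k, 'a, 'x) module_scheme \<Rightarrow> ('k, 'b, 'y) module_scheme \<Rightarrow> ('a \<Rightarrow> 'b) set"
  where
  "linear_maps R M N = {f \<in> carrier M \<rightarrow> carrier N.
     (\<forall>x\<in>carrier M. \<forall>y\<in>carrier M. f (x \<oplus>\<^bsub>M\<^esub> y) = f x \<oplus>\<^bsub>N\<^esub> f y) \<and>
     (\<forall>a\<in>carrier R. \<forall>x\<in>carrier M. f (a \<odot>\<^bsub>M\<^esub> x) = a \<odot>\<^bsub>N\<^esub> f x)}"

definition bilinear_maps ::
  "('k, 'r) ring_scheme \<Rightarrow> ('k, 'a, 'x) module_scheme \<Rightarrow> ('k, 'b, 'y) module_scheme \<Rightarrow>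
   ('k, 'c, 'z) module_scheme \<Rightarrow> ('a \<Rightarrow> 'b \<Rightarrow> 'c) set"
  where
  "bilinear_maps R M N P = {f.
     (\<forall>n\<in>carrier N. (\<lambda>m. f m n) \<in> linear_maps R M P) \<and>
     (\<forall>m\<in>carrier M. f m \<in> linear_maps R N P)}"


section \<open>Tensor products\<close>

text \<open>The tensor product of \<open>M\<close> and \<open>N\<close> is the free module on \<open>carrier M \<times> carrier N\<close> modulo the
  bilinearity relations. The ring components \<open>mult\<close> and \<open>one\<close> of the module records below carry
  no meaning.\<close>

definition free_module :: "('k, 'r) ring_scheme \<Rightarrow> 'x set \<Rightarrow> ('k, 'x \<Rightarrow> 'k) module" where
  "free_module R X = \<lparr>
     carrier = {\<phi>. (\<forall>x\<in>X. \<phi> x \<in> carrier R) \<and> (\<forall>x. x \<notin> X \<longrightarrow> \<phi> x = \<zero>\<^bsub>R\<^esub>) \<and> finite {x. \<phi> x \<noteq> \<zero>\<^bsub>R\<^esub>}},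
     mult = undefined, one = undefined,
     zero = (\<lambda>x. \<zero>\<^bsub>R\<^esub>),
     add = (\<lambda>\<phi> \<psi> x. \<phi> x \<oplus>\<^bsub>R\<^esub> \<psi> x),
     smult = (\<lambda>a \<phi> x. a \<otimes>\<^bsub>R\<^esub> \<phi> x)\<rparr>"

definition free_gen :: "('k, 'r) ring_scheme \<Rightarrow> 'x \<Rightarrow> ('x \<Rightarrow> 'k)" where
  "free_gen R x = (\<lambda>y. if y = x then \<one>\<^bsub>R\<^esub> else \<zero>\<^bsub>R\<^esub>)"

definition submodule_span ::
  "('k, 'r) ring_scheme \<Rightarrow> ('k, 'a, 'x) module_scheme \<Rightarrow> 'a set \<Rightarrow> 'a set" where
  "submodule_span R M S = \<Inter> {H. submodule H R M \<and> S \<subseteq> H}"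

text \<open>As in \<^const>\<open>FactRing\<close>, operations on cosets are given by representatives; all the cosets
  in the union below coincide.\<close>

definition quotient_module ::
  "('k, 'a, 'x) module_scheme \<Rightarrow> 'a set \<Rightarrow> ('k, 'a set) module" where
  "quotient_module M H = \<lparr>
     carrier = a_rcosets\<^bsub>M\<^esub> H,
     mult = undefined, one = undefined,
     zero = H,
     add = set_add M,
     smult = (\<lambda>a X. \<Union>x\<in>X. H +>\<^bsub>M\<^esub> (a \<odot>\<^bsub>M\<^esub> x))\<rparr>"

definition tensor_relations ::
  "('k, 'r) ring_scheme \<Rightarrow> ('k, 'a, 'x) module_scheme \<Rightarrow> ('k, 'b, 'y) module_scheme \<Rightarrow>
   ('a \<times> 'b \<Rightarrow> 'k) set" where
  "tensor_relations R M N = (let F = free_module R (carrier M \<times> carrier N); e = free_gen R in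
     submodule_span R F
       ({e (m \<oplus>\<^bsub>M\<^esub> m', n) \<ominus>\<^bsub>F\<^esub> (e (m, n) \<oplus>\<^bsub>F\<^esub> e (m', n)) | m m' n.
           m \<in> carrier M \<and> m' \<in> carrier M \<and> n \<in> carrier N} \<union>
        {e (m, n \<oplus>\<^bsub>N\<^esub> n') \<ominus>\<^bsub>F\<^esub> (e (m, n) \<oplus>\<^bsub>F\<^esub> e (m, n')) | m n n'.
           m \<in> carrier M \<and> n \<in> carrier N \<and> n' \<in> carrier N} \<union>
        {e (a \<odot>\<^bsub>M\<^esub> m, n) \<ominus>\<^bsub>F\<^esub> a \<odot>\<^bsub>F\<^esub> e (m, n) | a m n.
           a \<in> carrier R \<and> m \<in> carrier M \<and> n \<in> carrier N} \<union>
        {e (m, a \<odot>\<^bsub>N\<^esub> n) \<ominus>\<^bsub>F\<^esub> a \<odot>\<^bsub>F\<^esub> e (m, n) | a m n.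
           a \<in> carrier R \<and> m \<in> carrier M \<and> n \<in> carrier N}))"

definition tensor ::
  "('k, 'r) ring_scheme \<Rightarrow> ('k, 'a, 'x) module_scheme \<Rightarrow> ('k, 'b, 'y) module_scheme \<Rightarrow>
   ('k, ('a \<times> 'b \<Rightarrow> 'k) set) module" where
  "tensor R M N =
     quotient_module (free_module R (carrier M \<times> carrier N)) (tensor_relations R M N)"

definition pure_tensor ::
  "('k, 'r) ring_scheme \<Rightarrow> ('k, 'a, 'x) module_scheme \<Rightarrow> ('k, 'b, 'y) module_scheme \<Rightarrow>
   'a \<Rightarrow> 'b \<Rightarrow> ('a \<times> 'b \<Rightarrow> 'k) set" where
  "pure_tensor R M N m n =
     tensor_relations R M N +>\<^bsub>free_module R (carrier M \<times> carrier N)\<^esub> free_gen R (m, n)"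

text \<open>For bilinear \<open>f\<close>, the linear map on \<open>M \<otimes> N\<close> with \<open>m \<otimes> n \<mapsto> f m n\<close>; extensionality (the value
  \<^const>\<open>undefined\<close> outside the carrier) makes it unique as a HOL function.\<close>

definition tensor_lift ::
  "('k, 'r) ring_scheme \<Rightarrow> ('k, 'a, 'x) module_scheme \<Rightarrow> ('k, 'b, 'y) module_scheme \<Rightarrow>
   ('k, 'c, 'z) module_scheme \<Rightarrow> ('a \<Rightarrow> 'b \<Rightarrow> 'c) \<Rightarrow> ('a \<times> 'b \<Rightarrow> 'k) set \<Rightarrow> 'c" where
  "tensor_lift R M N P f = (THE h. h \<in> linear_maps R (tensor R M N) P \<and>
     h \<in> extensional (carrier (tensor R M N)) \<and>
     (\<forall>m\<in>carrier M. \<forall>n\<in>carrier N. h (pure_tensor R M N m n) = f m n))"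

text \<open>\<open>tensor_map R M N M' N' f g\<close> is \<open>f \<otimes> g : M \<otimes> N \<rightarrow> M' \<otimes> N'\<close>.\<close>

definition tensor_map ::
  "('k, 'r) ring_scheme \<Rightarrow> ('k, 'a, 'x) module_scheme \<Rightarrow> ('k, 'b, 'y) module_scheme \<Rightarrow>
   ('k, 'c, 'z) module_scheme \<Rightarrow> ('k, 'd, 'w) module_scheme \<Rightarrow>
   ('a \<Rightarrow> 'c) \<Rightarrow> ('b \<Rightarrow> 'd) \<Rightarrow> ('a \<times> 'b \<Rightarrow> 'k) set \<Rightarrow> ('c \<times> 'd \<Rightarrow> 'k) set" where
  "tensor_map R M N M' N' f g =
     tensor_lift R M N (tensor R M' N') (\<lambda>m n. pure_tensor R M' N' (f m) (g n))"

text \<open>The associator \<open>(A \<otimes> B) \<otimes> C \<rightarrow> A \<otimes> (B \<otimes> C)\<close> and its inverse.\<close>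

definition tensor_assoc ::
  "('k, 'r) ring_scheme \<Rightarrow> ('k, 'a, 'x) module_scheme \<Rightarrow> ('k, 'b, 'y) module_scheme \<Rightarrow>
   ('k, 'c, 'z) module_scheme \<Rightarrow>
   (('a \<times> 'b \<Rightarrow> 'k) set \<times> 'c \<Rightarrow> 'k) set \<Rightarrow> ('a \<times> ('b \<times> 'c \<Rightarrow> 'k) set \<Rightarrow> 'k) set" where
  "tensor_assoc R A B C =
     tensor_lift R (tensor R A B) C (tensor R A (tensor R B C))
       (\<lambda>x c. tensor_lift R A B (tensor R A (tensor R B C))
          (\<lambda>a b. pure_tensor R A (tensor R B C) a (pure_tensor R B C b c)) x)"

definition tensor_assoc_inv ::
  "('k, 'r) ring_scheme \<Rightarrow> ('k, 'a, 'x) module_scheme \<Rightarrow> ('k, 'b, 'y) module_scheme \<Rightarrow>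
   ('k, 'c, 'z) module_scheme \<Rightarrow>
   ('a \<times> ('b \<times> 'c \<Rightarrow> 'k) set \<Rightarrow> 'k) set \<Rightarrow> (('a \<times> 'b \<Rightarrow> 'k) set \<times> 'c \<Rightarrow> 'k) set" where
  "tensor_assoc_inv R A B C =
     tensor_lift R A (tensor R B C) (tensor R (tensor R A B) C)
       (\<lambda>a y. tensor_lift R B C (tensor R (tensor R A B) C)
          (\<lambda>b c. pure_tensor R (tensor R A B) C (pure_tensor R A B a b) c) y)"


section \<open>Leibniz algebras, crossed modules and their representations\<close>

record ('k, 'a) leibniz = "('k, 'a) module" +
  bracket :: "'a \<Rightarrow> 'a \<Rightarrow> 'a"

locale leibniz_algebra = module R L for R (structure) and L (structure) +
  assumes bracket_bilinear: "bracket L \<in> bilinear_maps R L L L"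
    and leibniz_identity: "\<lbrakk>v \<in> carrier L; w \<in> carrier L; u \<in> carrier L\<rbrakk> \<Longrightarrow>
      bracket L v (bracket L w u) =
        bracket L (bracket L v w) u \<ominus>\<^bsub>L\<^esub> bracket L (bracket L v u) w"

definition leibniz_morphisms ::
  "('k, 'r) ring_scheme \<Rightarrow> ('k, 'a, 'x) leibniz_scheme \<Rightarrow> ('k, 'b, 'y) leibniz_scheme \<Rightarrow>
   ('a \<Rightarrow> 'b) set" where
  "leibniz_morphisms R K G = {f \<in> linear_maps R K G.
     \<forall>x\<in>carrier K. \<forall>y\<in>carrier K. f (bracket K x y) = bracket G (f x) (f y)}"

definition leibniz_derivations ::
  "('k, 'r) ring_scheme \<Rightarrow> ('k, 'a, 'x) leibniz_scheme \<Rightarrow> ('a \<Rightarrow> 'a) set" where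
  "leibniz_derivations R K = {f \<in> linear_maps R K K.
     \<forall>x\<in>carrier K. \<forall>y\<in>carrier K. f (bracket K x y) = bracket K x (f y) \<oplus>\<^bsub>K\<^esub> bracket K (f x) y}"

definition leibniz_actions ::
  "('k, 'r) ring_scheme \<Rightarrow> ('k, 'g, 'x) leibniz_scheme \<Rightarrow> ('k, 'm, 'y) module_scheme \<Rightarrow>
   ('m \<Rightarrow> 'g \<Rightarrow> 'm) set" where
  "leibniz_actions R G M = {act \<in> bilinear_maps R M G M.
     \<forall>m\<in>carrier M. \<forall>g\<in>carrier G. \<forall>g'\<in>carrier G.
       act m (bracket G g g') = act (act m g) g' \<ominus>\<^bsub>M\<^esub> act (act m g') g}"

locale leibniz_crossed_module =
  K: leibniz_algebra R K + G: leibniz_algebra R G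
  for R (structure) and K (structure) and G (structure) +
  fixes \<pi> :: "'b \<Rightarrow> 'd" and cact :: "'b \<Rightarrow> 'd \<Rightarrow> 'b"
  assumes pi_morphism: "\<pi> \<in> leibniz_morphisms R K G"
    and cact_action: "cact \<in> leibniz_actions R G K"
    and cact_derivation: "g \<in> carrier G \<Longrightarrow> (\<lambda>k. cact k g) \<in> leibniz_derivations R K"
    and cact_pi: "\<lbrakk>k \<in> carrier K; k' \<in> carrier K\<rbrakk> \<Longrightarrow> cact k (\<pi> k') = bracket K k k'"
    and pi_cact: "\<lbrakk>k \<in> carrier K; g \<in> carrier G\<rbrakk> \<Longrightarrow> \<pi> (cact k g) = bracket G (\<pi> k) g"

text \<open>The operation of \<open>g\<close> on \<open>M \<otimes> K\<close> given by \<open>m \<otimes> k \<mapsto> m \<otimes> (k \<cdot> g) + (m * g) \<otimes> k\<close>.\<close>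

definition tensor_act ::
  "('k, 'r) ring_scheme \<Rightarrow> ('k, 'm, 'x) module_scheme \<Rightarrow> ('k, 'a, 'y) module_scheme \<Rightarrow>
   ('m \<Rightarrow> 'g \<Rightarrow> 'm) \<Rightarrow> ('a \<Rightarrow> 'g \<Rightarrow> 'a) \<Rightarrow> ('m \<times> 'a \<Rightarrow> 'k) set \<Rightarrow> 'g \<Rightarrow> ('m \<times> 'a \<Rightarrow> 'k) set" where
  "tensor_act R M K act cact t g =
     tensor_lift R M K (tensor R M K)
       (\<lambda>m k. pure_tensor R M K m (cact k g) \<oplus>\<^bsub>tensor R M K\<^esub> pure_tensor R M K (act m g) k) t"

locale crossed_module_representation =
  leibniz_crossed_module R K G \<pi> cact + M: module R M
  for R (structure) and K (structure) and G (structure) and \<pi> and cact and M (structure) +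
  fixes act :: "'e \<Rightarrow> 'd \<Rightarrow> 'e" and \<delta> :: "'e \<Rightarrow> ('e \<times> 'b \<Rightarrow> 'a) set"
  assumes act_action: "act \<in> leibniz_actions R G M"
    and delta_linear: "\<delta> \<in> linear_maps R M (tensor R M K)"
    and delta_square_zero: "m \<in> carrier M \<Longrightarrow>
      tensor_map R M K (tensor R M K) K \<delta> (\<lambda>k. k) (\<delta> m) = \<zero>\<^bsub>tensor R (tensor R M K) K\<^esub>"
    and delta_equivariant: "\<lbrakk>m \<in> carrier M; g \<in> carrier G\<rbrakk> \<Longrightarrow>
      \<delta> (act m g) = tensor_act R M K act cact (\<delta> m) g"


section \<open>Braided systems of vector spaces\<close>

text \<open>\<open>A \<otimes> f\<close> on \<open>(A \<otimes> B) \<otimes> C\<close> for \<open>f : B \<otimes> C \<rightarrow> C' \<otimes> B'\<close>, and similarly \<open>f \<otimes> C\<close> for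
  \<open>f : A \<otimes> B \<rightarrow> B' \<otimes> A'\<close>; threefold tensor products are bracketed to the left.\<close>

definition tensor_right ::
  "('k, 'r) ring_scheme \<Rightarrow> ('k, 'a, 'x) module_scheme \<Rightarrow> ('k, 'b, 'y) module_scheme \<Rightarrow>
   ('k, 'c, 'z) module_scheme \<Rightarrow> (('b \<times> 'c \<Rightarrow> 'k) set \<Rightarrow> ('c \<times> 'b \<Rightarrow> 'k) set) \<Rightarrow>
   (('a \<times> 'b \<Rightarrow> 'k) set \<times> 'c \<Rightarrow> 'k) set \<Rightarrow> (('a \<times> 'c \<Rightarrow> 'k) set \<times> 'b \<Rightarrow> 'k) set" where
  "tensor_right R A B C f =
     tensor_assoc_inv R A C B \<circ>
     tensor_map R A (tensor R B C) A (tensor R C B) (\<lambda>a. a) f \<circ>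
     tensor_assoc R A B C"

definition tensor_left ::
  "('k, 'r) ring_scheme \<Rightarrow> ('k, 'a, 'x) module_scheme \<Rightarrow> ('k, 'b, 'y) module_scheme \<Rightarrow>
   ('k, 'c, 'z) module_scheme \<Rightarrow> (('a \<times> 'b \<Rightarrow> 'k) set \<Rightarrow> ('b \<times> 'a \<Rightarrow> 'k) set) \<Rightarrow>
   (('a \<times> 'b \<Rightarrow> 'k) set \<times> 'c \<Rightarrow> 'k) set \<Rightarrow> (('b \<times> 'a \<Rightarrow> 'k) set \<times> 'c \<Rightarrow> 'k) set" where
  "tensor_left R A B C f = tensor_map R (tensor R A B) C (tensor R B A) C f (\<lambda>c. c)"

locale braided_system = field R for R (structure) +
  fixes r :: nat and V :: "nat \<Rightarrow> ('a, 'v, 'x) module_scheme"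
    and \<sigma> :: "nat \<Rightarrow> nat \<Rightarrow> ('v \<times> 'v \<Rightarrow> 'a) set \<Rightarrow> ('v \<times> 'v \<Rightarrow> 'a) set"
  assumes V_module: "i \<in> {1..r} \<Longrightarrow> module R (V i)"
    and sigma_linear: "\<lbrakk>i \<in> {1..r}; j \<in> {1..r}; i \<le> j\<rbrakk> \<Longrightarrow>
      \<sigma> i j \<in> linear_maps R (tensor R (V i) (V j)) (tensor R (V j) (V i))"
    and yang_baxter: "\<lbrakk>i \<in> {1..r}; j \<in> {1..r}; k \<in> {1..r}; i \<le> j; j \<le> k;
      x \<in> carrier (tensor R (tensor R (V i) (V j)) (V k))\<rbrakk> \<Longrightarrow>
      (tensor_left R (V j) (V k) (V i) (\<sigma> j k) \<circ>
       tensor_right R (V j) (V i) (V k) (\<sigma> i k) \<circ>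
       tensor_left R (V i) (V j) (V k) (\<sigma> i j)) x =
      (tensor_right R (V k) (V i) (V j) (\<sigma> i j) \<circ>
       tensor_left R (V i) (V k) (V j) (\<sigma> i k) \<circ>
       tensor_right R (V i) (V j) (V k) (\<sigma> j k)) x"

text \<open>The linear map \<open>m \<otimes> n \<mapsto> n \<otimes> m + n\<^sub>0 \<otimes> (m * \<pi> n\<^sub>1)\<close> on \<open>M \<otimes> N\<close>, where \<open>\<delta> n = n\<^sub>0 \<otimes> n\<^sub>1\<close> in
  \<open>N \<otimes> K\<close>; the Sweedler term is the image of \<open>\<delta> n\<close> under \<open>Id \<otimes> (m * \<pi> (-)) : N \<otimes> K \<rightarrow> N \<otimes> M\<close>.\<close>

definition leibniz_braiding ::
  "('k, 'r) ring_scheme \<Rightarrow> ('k, 'a, 'x) module_scheme \<Rightarrow> ('a \<Rightarrow> 'g) \<Rightarrow>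
   ('k, 'm, 'y) module_scheme \<Rightarrow> ('m \<Rightarrow> 'g \<Rightarrow> 'm) \<Rightarrow>
   ('k, 'n, 'z) module_scheme \<Rightarrow> ('n \<Rightarrow> ('n \<times> 'a \<Rightarrow> 'k) set) \<Rightarrow>
   ('m \<times> 'n \<Rightarrow> 'k) set \<Rightarrow> ('n \<times> 'm \<Rightarrow> 'k) set" where
  "leibniz_braiding R K \<pi> M act N \<delta> =
     tensor_lift R M N (tensor R N M)
       (\<lambda>m n. pure_tensor R N M n m \<oplus>\<^bsub>tensor R N M\<^esub>
          tensor_map R N K N M (\<lambda>n'. n') (\<lambda>k. act m (\<pi> k)) (\<delta> n))"

end

theory Submission
  imports Defs
begin

text \<open>Write \<open>m * k\<close> for \<open>m * \<pi> k\<close> and \<open>\<delta> n = n\<^sub>0 \<otimes> n\<^sub>1\<close>. Evaluating both sides of the Yang-Baxter equation on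
\<open>m \<otimes> n \<otimes> p\<close> gives sums of tensors in \<open>P \<otimes> N \<otimes> M\<close>. Whenever two crossings in succession both use the coaction
of \<open>p\<close>, the result is a linear image of \<open>(\<delta> \<otimes> Id) (\<delta> p)\<close>, which vanishes. What remains on the left is
\<open>p \<otimes> n \<otimes> m + p\<^sub>0 \<otimes> n * p\<^sub>1 \<otimes> m + p\<^sub>0 \<otimes> n \<otimes> m * p\<^sub>1 + p \<otimes> n\<^sub>0 \<otimes> m * n\<^sub>1 + p\<^sub>0 \<otimes> n\<^sub>0 * p\<^sub>1 \<otimes> m * n\<^sub>1 + p\<^sub>0 \<otimes> n\<^sub>0 \<otimes> (m * n\<^sub>1) * p\<^sub>1\<close>,
and on the right the same first four terms together with
\<open>p\<^sub>0 \<otimes> n\<^sub>0 \<otimes> (m * p\<^sub>1) * n\<^sub>1 + p\<^sub>0 \<otimes> (n * p\<^sub>1)\<^sub>0 \<otimes> m * (n * p\<^sub>1)\<^sub>1\<close>. Equivariance of \<open>\<delta>\<close> splits the last summand into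
\<open>p\<^sub>0 \<otimes> n\<^sub>0 * p\<^sub>1 \<otimes> m * n\<^sub>1\<close> and \<open>p\<^sub>0 \<otimes> n\<^sub>0 \<otimes> m * (n\<^sub>1 \<cdot> \<pi> p\<^sub>1)\<close>. Since \<open>\<pi> (n\<^sub>1 \<cdot> \<pi> p\<^sub>1) = [\<pi> n\<^sub>1, \<pi> p\<^sub>1]\<close>, the axiom
of an action turns the latter into \<open>p\<^sub>0 \<otimes> n\<^sub>0 \<otimes> ((m * n\<^sub>1) * p\<^sub>1 - (m * p\<^sub>1) * n\<^sub>1)\<close>, and the two sides agree.

The calculation never expands a Sweedler sum. An expression in \<open>n\<^sub>0 \<otimes> n\<^sub>1\<close> is the value at \<open>\<delta> n\<close> of a linear map on
\<open>N \<otimes> K\<close>, and two such maps are equal as soon as they agree on pure tensors (\<open>tensor_ext\<close>). Hence the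
first parts construct tensor products as modules with their universal property (\<open>tensor_lift\<close>). The
vanishing of the quadratic terms is \<open>braiding_past_two\<close>, which serves both sides of the equation, with the
roles of \<open>m\<close> and \<open>n\<close> exchanged; the comparison of the terms in which both coactions occur is
\<open>double_by_N_eq_double_by_P\<close>. Likewise the Sweedler term of \<open>\<sigma> (m \<otimes> n)\<close> is a linear map applied to \<open>\<delta> n\<close>, so the
formula for \<open>\<sigma>\<close> holds for every way of writing \<open>\<delta> n\<close> as a sum of pure tensors.\<close>

section \<open>Linear maps\<close>

lemma linear_mapsI:
  assumes "\<And>x. x \<in> carrier M \<Longrightarrow> f x \<in> carrier N"
    and "\<And>x y. x \<in> carrier M \<Longrightarrow> y \<in> carrier M \<Longrightarrow> f (x \<oplus>\<^bsub>M\<^esub> y) = f x \<oplus>\<^bsub>N\<^esub> f y"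
    and "\<And>a x. a \<in> carrier R \<Longrightarrow> x \<in> carrier M \<Longrightarrow> f (a \<odot>\<^bsub>M\<^esub> x) = a \<odot>\<^bsub>N\<^esub> f x"
  shows "f \<in> linear_maps R M N"
  using assms by (auto simp: linear_maps_def)

lemma linear_closed: "f \<in> linear_maps R M N \<Longrightarrow> x \<in> carrier M \<Longrightarrow> f x \<in> carrier N"
  by (auto simp: linear_maps_def)

lemma linear_add:
  "f \<in> linear_maps R M N \<Longrightarrow> x \<in> carrier M \<Longrightarrow> y \<in> carrier M \<Longrightarrow>
    f (x \<oplus>\<^bsub>M\<^esub> y) = f x \<oplus>\<^bsub>N\<^esub> f y"
  by (auto simp: linear_maps_def)

lemma linear_smult:
  "f \<in> linear_maps R M N \<Longrightarrow> a \<in> carrier R \<Longrightarrow> x \<in> carrier M \<Longrightarrow>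
    f (a \<odot>\<^bsub>M\<^esub> x) = a \<odot>\<^bsub>N\<^esub> f x"
  by (auto simp: linear_maps_def)

lemma linear_id: "(\<lambda>x. x) \<in> linear_maps R M M"
  by (auto intro: linear_mapsI)

lemma linear_comp:
  assumes "f \<in> linear_maps R M N" "g \<in> linear_maps R N P"
  shows "(\<lambda>x. g (f x)) \<in> linear_maps R M P"
  using assms by (intro linear_mapsI) (simp_all add: linear_closed linear_add linear_smult)

lemma linear_cong:
  assumes "f \<in> linear_maps R M N" "\<And>x. x \<in> carrier M \<Longrightarrow> g x = f x" "module R M"
  shows "g \<in> linear_maps R M N"
proof -
  interpret M: module R M by fact
  show ?thesis using assms(1,2) by (auto simp: linear_maps_def)
qed

lemma linear_zero:
  assumes "f \<in> linear_maps R M N" "module R M" "module R N"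
  shows "f \<zero>\<^bsub>M\<^esub> = \<zero>\<^bsub>N\<^esub>"
proof -
  interpret M: module R M by fact
  interpret N: module R N by fact
  have "f (\<zero>\<^bsub>R\<^esub> \<odot>\<^bsub>M\<^esub> \<zero>\<^bsub>M\<^esub>) = \<zero>\<^bsub>R\<^esub> \<odot>\<^bsub>N\<^esub> f \<zero>\<^bsub>M\<^esub>"
    using assms(1) by (intro linear_smult) auto
  then show ?thesis
    using linear_closed[OF assms(1) M.zero_closed] by simp
qed

lemma linear_uminus:
  assumes "f \<in> linear_maps R M N" "module R M" "module R N" "x \<in> carrier M"
  shows "f (\<ominus>\<^bsub>M\<^esub> x) = \<ominus>\<^bsub>N\<^esub> f x"
proof -
  interpret M: module R M by fact
  interpret N: module R N by fact
  have "f ((\<ominus>\<^bsub>R\<^esub> \<one>\<^bsub>R\<^esub>) \<odot>\<^bsub>M\<^esub> x) = (\<ominus>\<^bsub>R\<^esub> \<one>\<^bsub>R\<^esub>) \<odot>\<^bsub>N\<^esub> f x"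
    using assms by (intro linear_smult) auto
  then show ?thesis
    using linear_closed[OF assms(1,4)] assms(4) by (simp add: M.smult_l_minus N.smult_l_minus)
qed

lemma linear_minus:
  assumes "f \<in> linear_maps R M N" "module R M" "module R N" "x \<in> carrier M" "y \<in> carrier M"
  shows "f (x \<ominus>\<^bsub>M\<^esub> y) = f x \<ominus>\<^bsub>N\<^esub> f y"
proof -
  interpret M: module R M by fact
  interpret N: module R N by fact
  show ?thesis
    using assms(4,5) by (simp add: a_minus_def linear_add[OF assms(1)] linear_uminus[OF assms(1-3)])
qed

lemma linear_finsum:
  assumes "f \<in> linear_maps R M N" "module R M" "module R N" "finite A" "g \<in> A \<rightarrow> carrier M"
  shows "f (finsum M g A) = (\<Oplus>\<^bsub>N\<^esub>s\<in>A. f (g s))"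
proof -
  interpret M: module R M by fact
  interpret N: module R N by fact
  show ?thesis
    using assms(4,5)
  proof (induction A rule: finite_induct)
    case empty
    show ?case by (simp add: linear_zero[OF assms(1-3)])
  next
    case (insert s A)
    then have "g \<in> A \<rightarrow> carrier M" "g s \<in> carrier M" by auto
    moreover from this have "(\<lambda>s. f (g s)) \<in> A \<rightarrow> carrier N" "f (g s) \<in> carrier N"
      using linear_closed[OF assms(1)] by auto
    ultimately show ?case
      using insert by (simp add: linear_add[OF assms(1)])
  qed
qed

lemma linear_plus:
  assumes "f \<in> linear_maps R M N" "g \<in> linear_maps R M N" "module R N"
  shows "(\<lambda>x. f x \<oplus>\<^bsub>N\<^esub> g x) \<in> linear_maps R M N"
proof -
  interpret N: module R N by fact
  show ?thesis
    using assms(1,2)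
    by (intro linear_mapsI)
      (auto simp: linear_add linear_smult linear_closed N.smult_r_distr N.a_ac)
qed

lemma linear_kernel_submodule:
  assumes "f \<in> linear_maps R M N" "module R M" "module R N"
  shows "submodule {x \<in> carrier M. f x = \<zero>\<^bsub>N\<^esub>} R M"
proof -
  interpret M: module R M by fact
  interpret N: module R N by fact
  show ?thesis
    by (rule M.submoduleI)
      (auto simp: linear_zero[OF assms] linear_uminus[OF assms] linear_add[OF assms(1)]
        linear_smult[OF assms(1)])
qed


section \<open>Free modules\<close>

lemma free_module_simps [simp]:
  "\<zero>\<^bsub>free_module R X\<^esub> = (\<lambda>x. \<zero>\<^bsub>R\<^esub>)"
  "\<phi> \<oplus>\<^bsub>free_module R X\<^esub> \<psi> = (\<lambda>x. \<phi> x \<oplus>\<^bsub>R\<^esub> \<psi> x)"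
  "a \<odot>\<^bsub>free_module R X\<^esub> \<phi> = (\<lambda>x. a \<otimes>\<^bsub>R\<^esub> \<phi> x)"
  by (simp_all add: free_module_def)

lemma free_module_carrier_iff:
  "\<phi> \<in> carrier (free_module R X) \<longleftrightarrow>
    (\<forall>x\<in>X. \<phi> x \<in> carrier R) \<and> (\<forall>x. x \<notin> X \<longrightarrow> \<phi> x = \<zero>\<^bsub>R\<^esub>) \<and> finite {x. \<phi> x \<noteq> \<zero>\<^bsub>R\<^esub>}"
  by (simp add: free_module_def)

lemma (in cring) free_module_coeff_closed:
  "\<phi> \<in> carrier (free_module R X) \<Longrightarrow> \<phi> x \<in> carrier R"
  by (cases "x \<in> X") (auto simp: free_module_carrier_iff)

lemma (in cring) free_module_is_module: "module R (free_module R X)"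
proof (rule moduleI)
  let ?F = "free_module R X"
  have add: "(\<lambda>x. \<phi> x \<oplus> \<psi> x) \<in> carrier ?F"
    if "\<phi> \<in> carrier ?F" "\<psi> \<in> carrier ?F" for \<phi> \<psi>
  proof -
    have "finite ({x. \<phi> x \<noteq> \<zero>} \<union> {x. \<psi> x \<noteq> \<zero>})"
      using that by (simp add: free_module_carrier_iff)
    then have "finite {x. \<phi> x \<oplus> \<psi> x \<noteq> \<zero>}"
      by (rule finite_subset[rotated]) auto
    with that show ?thesis
      by (auto simp: free_module_carrier_iff)
  qed
  have smult: "(\<lambda>x. a \<otimes> \<phi> x) \<in> carrier ?F"
    if "a \<in> carrier R" "\<phi> \<in> carrier ?F" for a \<phi>
  proof -
    have "finite {x. \<phi> x \<noteq> \<zero>}"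
      using that by (simp add: free_module_carrier_iff)
    then have "finite {x. a \<otimes> \<phi> x \<noteq> \<zero>}"
      by (rule finite_subset[rotated]) (use that in auto)
    with that show ?thesis
      by (auto simp: free_module_carrier_iff)
  qed
  show "cring R" by (rule is_cring)
  show "abelian_group ?F"
  proof (rule abelian_groupI)
    fix \<phi> assume \<phi>: "\<phi> \<in> carrier ?F"
    have "(\<lambda>x. (\<ominus> \<one>) \<otimes> \<phi> x) \<in> carrier ?F"
      using \<phi> by (intro smult) auto
    moreover have "(\<lambda>x. (\<ominus> \<one>) \<otimes> \<phi> x) \<oplus>\<^bsub>?F\<^esub> \<phi> = \<zero>\<^bsub>?F\<^esub>"
      using free_module_coeff_closed[OF \<phi>] by (auto simp: l_minus l_neg)
    ultimately show "\<exists>\<psi>\<in>carrier ?F. \<psi> \<oplus>\<^bsub>?F\<^esub> \<phi> = \<zero>\<^bsub>?F\<^esub>" by blast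
  qed (auto simp: add a_ac free_module_coeff_closed, auto simp: free_module_carrier_iff)
  show "a \<odot>\<^bsub>?F\<^esub> \<phi> \<in> carrier ?F" if "a \<in> carrier R" "\<phi> \<in> carrier ?F" for a \<phi>
    using smult[OF that] by simp
qed (auto simp: free_module_coeff_closed l_distr r_distr m_assoc)

lemma (in cring) free_gen_closed: "x \<in> X \<Longrightarrow> free_gen R x \<in> carrier (free_module R X)"
  by (auto simp: free_module_carrier_iff free_gen_def)

text \<open>Elements of finite support are reached from \<open>\<zero>\<close> by adding one multiple of a generator at a time; this is
what later reduces statements about tensors to pure tensors.\<close>

lemma (in cring) free_module_induct [consumes 1, case_names zero add]:
  assumes "\<phi> \<in> carrier (free_module R X)"
    and zero: "P (\<lambda>x. \<zero>)"
    and add: "\<And>\<phi> a x. \<phi> \<in> carrier (free_module R X) \<Longrightarrow> P \<phi> \<Longrightarrow> a \<in> carrier R \<Longrightarrow> x \<in> X \<Longrightarrow>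
      P (\<phi> \<oplus>\<^bsub>free_module R X\<^esub> (a \<odot>\<^bsub>free_module R X\<^esub> free_gen R x))"
  shows "P \<phi>"
proof -
  have "P \<phi>" if "finite S" "{x. \<phi> x \<noteq> \<zero>} \<subseteq> S" "\<phi> \<in> carrier (free_module R X)" for S \<phi>
    using that
  proof (induction S arbitrary: \<phi> rule: finite_induct)
    case empty
    then have "\<phi> = (\<lambda>x. \<zero>)" by auto
    then show ?case using zero by simp
  next
    case (insert y S)
    show ?case
    proof (cases "\<phi> y = \<zero>")
      case True
      then show ?thesis using insert by (intro insert.IH) auto
    next
      case False
      let ?\<psi> = "\<phi>(y := \<zero>)"
      have y: "y \<in> X" using False insert.prems by (auto simp: free_module_carrier_iff)
      have supp: "{x. ?\<psi> x \<noteq> \<zero>} \<subseteq> S" using insert.prems by auto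
      then have \<psi>: "?\<psi> \<in> carrier (free_module R X)"
        using insert.prems insert.hyps finite_subset[OF supp]
        by (auto simp: free_module_carrier_iff)
      have "\<phi> = ?\<psi> \<oplus>\<^bsub>free_module R X\<^esub> (\<phi> y \<odot>\<^bsub>free_module R X\<^esub> free_gen R y)"
        using free_module_coeff_closed[OF insert.prems(2)] by (auto simp: free_gen_def)
      moreover have "P (?\<psi> \<oplus>\<^bsub>free_module R X\<^esub> (\<phi> y \<odot>\<^bsub>free_module R X\<^esub> free_gen R y))"
        using \<psi> free_module_coeff_closed[OF insert.prems(2)] y
        by (intro add insert.IH[OF supp])
      ultimately show ?thesis by simp
    qed
  qed
  then show ?thesis using assms(1) by (auto simp: free_module_carrier_iff)
qed

text \<open>The values on the generators extend linearly by summing over the support. Additivity needs sums over a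
common finite set, so the sum is first shown to be unchanged on any finite set containing the support.\<close>

lemma free_module_universal:
  assumes "module R P" "\<And>x. x \<in> X \<Longrightarrow> f x \<in> carrier P"
  obtains h where "h \<in> linear_maps R (free_module R X) P"
    "\<And>x. x \<in> X \<Longrightarrow> h (free_gen R x) = f x"
proof -
  interpret P: module R P by fact
  define h where "h \<phi> = (\<Oplus>\<^bsub>P\<^esub>x\<in>{x. \<phi> x \<noteq> \<zero>\<^bsub>R\<^esub>}. \<phi> x \<odot>\<^bsub>P\<^esub> f x)" for \<phi>
  have pi: "(\<lambda>x. \<phi> x \<odot>\<^bsub>P\<^esub> f x) \<in> S \<rightarrow> carrier P"
    if "\<phi> \<in> carrier (free_module R X)" "S \<subseteq> X" for \<phi> S
    using that assms(2) P.R.free_module_coeff_closed[OF that(1)] by auto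
  have h_eq: "h \<phi> = (\<Oplus>\<^bsub>P\<^esub>x\<in>S. \<phi> x \<odot>\<^bsub>P\<^esub> f x)"
    if "\<phi> \<in> carrier (free_module R X)" "finite S" "{x. \<phi> x \<noteq> \<zero>\<^bsub>R\<^esub>} \<subseteq> S" "S \<subseteq> X" for \<phi> S
    unfolding h_def using that assms(2) pi[OF that(1,4)]
    by (intro P.add.finprod_mono_neutral_cong_left) auto
  have supp: "{x. \<phi> x \<noteq> \<zero>\<^bsub>R\<^esub>} \<subseteq> X" "finite {x. \<phi> x \<noteq> \<zero>\<^bsub>R\<^esub>}"
    if "\<phi> \<in> carrier (free_module R X)" for \<phi>
    using that by (auto simp: free_module_carrier_iff)
  interpret F: module R "free_module R X" by (rule P.R.free_module_is_module)
  show ?thesis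
  proof
    show "h \<in> linear_maps R (free_module R X) P"
    proof (rule linear_mapsI)
      fix \<phi> assume "\<phi> \<in> carrier (free_module R X)"
      then show "h \<phi> \<in> carrier P"
        unfolding h_def using pi supp by (intro P.finsum_closed) auto
    next
      fix \<phi> \<psi> assume *: "\<phi> \<in> carrier (free_module R X)" "\<psi> \<in> carrier (free_module R X)"
      let ?S = "{x. \<phi> x \<noteq> \<zero>\<^bsub>R\<^esub>} \<union> {x. \<psi> x \<noteq> \<zero>\<^bsub>R\<^esub>}"
      have S: "finite ?S" "?S \<subseteq> X" using supp * by auto
      have "h (\<phi> \<oplus>\<^bsub>free_module R X\<^esub> \<psi>) =
          (\<Oplus>\<^bsub>P\<^esub>x\<in>?S. (\<phi> \<oplus>\<^bsub>free_module R X\<^esub> \<psi>) x \<odot>\<^bsub>P\<^esub> f x)"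
        using * S F.a_closed[OF *] by (intro h_eq) auto
      also have "\<dots> = (\<Oplus>\<^bsub>P\<^esub>x\<in>?S. \<phi> x \<odot>\<^bsub>P\<^esub> f x \<oplus>\<^bsub>P\<^esub> \<psi> x \<odot>\<^bsub>P\<^esub> f x)"
        using * S assms(2) P.R.free_module_coeff_closed[OF *(1)] P.R.free_module_coeff_closed[OF *(2)]
        by (intro P.finsum_cong') (auto simp: P.smult_l_distr)
      also have "\<dots> = h \<phi> \<oplus>\<^bsub>P\<^esub> h \<psi>"
        using * S pi by (simp add: h_eq[where S = ?S] P.finsum_addf)
      finally show "h (\<phi> \<oplus>\<^bsub>free_module R X\<^esub> \<psi>) = h \<phi> \<oplus>\<^bsub>P\<^esub> h \<psi>" .
    next
      fix a \<phi> assume *: "a \<in> carrier R" "\<phi> \<in> carrier (free_module R X)"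
      let ?S = "{x. \<phi> x \<noteq> \<zero>\<^bsub>R\<^esub>}"
      have S: "finite ?S" "?S \<subseteq> X" using supp * by auto
      have "h (a \<odot>\<^bsub>free_module R X\<^esub> \<phi>) =
          (\<Oplus>\<^bsub>P\<^esub>x\<in>?S. (a \<odot>\<^bsub>free_module R X\<^esub> \<phi>) x \<odot>\<^bsub>P\<^esub> f x)"
        using * S F.smult_closed[OF *] by (intro h_eq) auto
      also have "\<dots> = (\<Oplus>\<^bsub>P\<^esub>x\<in>?S. a \<odot>\<^bsub>P\<^esub> (\<phi> x \<odot>\<^bsub>P\<^esub> f x))"
        using * S assms(2) P.R.free_module_coeff_closed[OF *(2)]
        by (intro P.finsum_cong') (auto simp: P.smult_assoc1)
      also have "\<dots> = a \<odot>\<^bsub>P\<^esub> h \<phi>"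
        using * S pi unfolding h_def by (subst P.finsum_smult_ldistr) auto
      finally show "h (a \<odot>\<^bsub>free_module R X\<^esub> \<phi>) = a \<odot>\<^bsub>P\<^esub> h \<phi>" .
    qed
    fix x assume x: "x \<in> X"
    have "h (free_gen R x) = (\<Oplus>\<^bsub>P\<^esub>y\<in>{x}. free_gen R x y \<odot>\<^bsub>P\<^esub> f y)"
      using x P.R.free_gen_closed[OF x] by (intro h_eq) (auto simp: free_gen_def)
    also have "\<dots> = f x"
      using x assms(2) by (simp add: free_gen_def)
    finally show "h (free_gen R x) = f x" .
  qed
qed


section \<open>Quotient modules\<close>

lemma submodule_abelian_subgroup:
  assumes "module R M" "submodule H R M"
  shows "abelian_subgroup H M"
  using assms by (intro abelian_subgroupI3 additive_subgroup.intro)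
    (auto simp: submodule_def module_def)

lemma submodule_span_submodule:
  assumes "module R M" "S \<subseteq> carrier M"
  shows "submodule (submodule_span R M S) R M" "S \<subseteq> submodule_span R M S"
proof -
  interpret M: module R M by fact
  show "submodule (submodule_span R M S) R M"
  proof (rule M.submoduleI)
    show "submodule_span R M S \<subseteq> carrier M"
      using assms(2) M.carrier_is_submodule by (auto simp: submodule_span_def)
  next
    show "\<zero>\<^bsub>M\<^esub> \<in> submodule_span R M S"
      by (auto simp: submodule_span_def submodule_def dest: subgroup.one_closed)
  next
    fix a assume "a \<in> submodule_span R M S"
    then show "\<ominus>\<^bsub>M\<^esub> a \<in> submodule_span R M S"
      by (simp add: submodule_span_def M.submoduleE(3))
  next
    fix a b assume "a \<in> submodule_span R M S" "b \<in> submodule_span R M S"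
    then show "a \<oplus>\<^bsub>M\<^esub> b \<in> submodule_span R M S"
      by (simp add: submodule_span_def M.submoduleE(5))
  next
    fix a x assume "a \<in> carrier R" "x \<in> submodule_span R M S"
    then show "a \<odot>\<^bsub>M\<^esub> x \<in> submodule_span R M S"
      by (simp add: submodule_span_def M.submoduleE(4))
  qed
  show "S \<subseteq> submodule_span R M S" by (auto simp: submodule_span_def)
qed

lemma submodule_span_least:
  "submodule H R M \<Longrightarrow> S \<subseteq> H \<Longrightarrow> submodule_span R M S \<subseteq> H"
  by (auto simp: submodule_span_def)

context
  fixes R :: "('k, 'r) ring_scheme" and M :: "('k, 'a, 'x) module_scheme" and H :: "'a set"
  assumes M: "module R M" and H: "submodule H R M"
begin

interpretation M: module R M by (rule M)
interpretation H: submodule H R M by (rule H)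
interpretation HS: abelian_subgroup H M by (rule submodule_abelian_subgroup[OF M H])

lemma quotient_carrier: "carrier (quotient_module M H) = {H +>\<^bsub>M\<^esub> x | x. x \<in> carrier M}"
  by (auto simp: quotient_module_def A_RCOSETS_def')

lemma quotient_add: "x \<in> carrier M \<Longrightarrow> y \<in> carrier M \<Longrightarrow>
  (H +>\<^bsub>M\<^esub> x) \<oplus>\<^bsub>quotient_module M H\<^esub> (H +>\<^bsub>M\<^esub> y) = H +>\<^bsub>M\<^esub> (x \<oplus>\<^bsub>M\<^esub> y)"
  by (simp add: quotient_module_def HS.a_rcos_sum)

lemma quotient_zero: "\<zero>\<^bsub>quotient_module M H\<^esub> = H +>\<^bsub>M\<^esub> \<zero>\<^bsub>M\<^esub>"
  using HS.a_subset by (simp add: quotient_module_def)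

lemma coset_mem_iff: "x \<in> carrier M \<Longrightarrow> y \<in> H +>\<^bsub>M\<^esub> x \<longleftrightarrow> (\<exists>h\<in>H. y = h \<oplus>\<^bsub>M\<^esub> x)"
  by (auto simp: a_r_coset_def')

lemma coset_eqI: "y \<in> H +>\<^bsub>M\<^esub> x \<Longrightarrow> x \<in> carrier M \<Longrightarrow> H +>\<^bsub>M\<^esub> x = H +>\<^bsub>M\<^esub> y"
  by (intro M.M.a_repr_independence HS.a_subgroup)

text \<open>The scalar multiple of a coset is a union over its representatives. It collapses to a single coset because
\<open>a \<odot> (h \<oplus> x)\<close> and \<open>a \<odot> x\<close> differ by the element \<open>a \<odot> h\<close> of the submodule.\<close>

lemma quotient_smult:
  assumes "a \<in> carrier R" "x \<in> carrier M"
  shows "a \<odot>\<^bsub>quotient_module M H\<^esub> (H +>\<^bsub>M\<^esub> x) = H +>\<^bsub>M\<^esub> (a \<odot>\<^bsub>M\<^esub> x)"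
proof -
  have "H +>\<^bsub>M\<^esub> (a \<odot>\<^bsub>M\<^esub> y) = H +>\<^bsub>M\<^esub> (a \<odot>\<^bsub>M\<^esub> x)" if y: "y \<in> H +>\<^bsub>M\<^esub> x" for y
  proof -
    obtain h where h: "h \<in> H" "y = h \<oplus>\<^bsub>M\<^esub> x" using y coset_mem_iff[OF assms(2)] by blast
    moreover from this have "h \<in> carrier M" using HS.a_subset by blast
    ultimately have "a \<odot>\<^bsub>M\<^esub> y = a \<odot>\<^bsub>M\<^esub> h \<oplus>\<^bsub>M\<^esub> a \<odot>\<^bsub>M\<^esub> x"
      using assms by (simp add: M.smult_r_distr)
    then have "a \<odot>\<^bsub>M\<^esub> y \<in> H +>\<^bsub>M\<^esub> (a \<odot>\<^bsub>M\<^esub> x)"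
      using h(1) assms by (subst coset_mem_iff) auto
    then show ?thesis using assms by (intro coset_eqI[symmetric]) auto
  qed
  moreover have "x \<in> H +>\<^bsub>M\<^esub> x" using assms HS.a_rcos_self by auto
  ultimately have "(\<Union>y\<in>H +>\<^bsub>M\<^esub> x. H +>\<^bsub>M\<^esub> (a \<odot>\<^bsub>M\<^esub> y)) = H +>\<^bsub>M\<^esub> (a \<odot>\<^bsub>M\<^esub> x)"
    by blast
  then show ?thesis by (simp add: quotient_module_def)
qed

lemma quotient_module_is_module: "module R (quotient_module M H)"
proof (rule moduleI)
  let ?Q = "quotient_module M H"
  show "abelian_group ?Q"
  proof (rule abelian_groupI)
    fix X assume "X \<in> carrier ?Q"
    then obtain x where x: "x \<in> carrier M" "X = H +>\<^bsub>M\<^esub> x" by (auto simp: quotient_carrier)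
    then have "(H +>\<^bsub>M\<^esub> (\<ominus>\<^bsub>M\<^esub> x)) \<oplus>\<^bsub>?Q\<^esub> X = \<zero>\<^bsub>?Q\<^esub>"
      by (simp add: quotient_add quotient_zero M.M.l_neg)
    moreover have "H +>\<^bsub>M\<^esub> (\<ominus>\<^bsub>M\<^esub> x) \<in> carrier ?Q"
      using x by (auto simp: quotient_carrier)
    ultimately show "\<exists>Y\<in>carrier ?Q. Y \<oplus>\<^bsub>?Q\<^esub> X = \<zero>\<^bsub>?Q\<^esub>" by blast
  next
    fix X Y assume "X \<in> carrier ?Q" "Y \<in> carrier ?Q"
    then obtain x y where "x \<in> carrier M" "y \<in> carrier M" "X = H +>\<^bsub>M\<^esub> x" "Y = H +>\<^bsub>M\<^esub> y"
      by (auto simp: quotient_carrier)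
    then show "X \<oplus>\<^bsub>?Q\<^esub> Y \<in> carrier ?Q" "X \<oplus>\<^bsub>?Q\<^esub> Y = Y \<oplus>\<^bsub>?Q\<^esub> X"
      by (auto simp: quotient_carrier quotient_add M.M.a_comm)
  next
    fix X Y Z assume "X \<in> carrier ?Q" "Y \<in> carrier ?Q" "Z \<in> carrier ?Q"
    then show "X \<oplus>\<^bsub>?Q\<^esub> Y \<oplus>\<^bsub>?Q\<^esub> Z = X \<oplus>\<^bsub>?Q\<^esub> (Y \<oplus>\<^bsub>?Q\<^esub> Z)"
      by (auto simp: quotient_carrier quotient_add M.M.a_assoc)
  next
    show "\<zero>\<^bsub>?Q\<^esub> \<in> carrier ?Q" by (auto simp: quotient_carrier quotient_zero)
    fix X assume "X \<in> carrier ?Q"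
    then show "\<zero>\<^bsub>?Q\<^esub> \<oplus>\<^bsub>?Q\<^esub> X = X"
      by (auto simp: quotient_carrier quotient_zero quotient_add)
  qed
next
  fix a X assume "a \<in> carrier R" "X \<in> carrier (quotient_module M H)"
  then show "a \<odot>\<^bsub>quotient_module M H\<^esub> X \<in> carrier (quotient_module M H)"
    by (auto simp: quotient_carrier quotient_smult)
next
  fix a b X assume "a \<in> carrier R" "b \<in> carrier R" "X \<in> carrier (quotient_module M H)"
  then show "(a \<oplus>\<^bsub>R\<^esub> b) \<odot>\<^bsub>quotient_module M H\<^esub> X =
      a \<odot>\<^bsub>quotient_module M H\<^esub> X \<oplus>\<^bsub>quotient_module M H\<^esub> b \<odot>\<^bsub>quotient_module M H\<^esub> X"
    "(a \<otimes>\<^bsub>R\<^esub> b) \<odot>\<^bsub>quotient_module M H\<^esub> X =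
      a \<odot>\<^bsub>quotient_module M H\<^esub> (b \<odot>\<^bsub>quotient_module M H\<^esub> X)"
    by (auto simp: quotient_carrier quotient_smult quotient_add M.smult_l_distr M.smult_assoc1)
next
  fix a X Y
  assume "a \<in> carrier R" "X \<in> carrier (quotient_module M H)" "Y \<in> carrier (quotient_module M H)"
  then show "a \<odot>\<^bsub>quotient_module M H\<^esub> (X \<oplus>\<^bsub>quotient_module M H\<^esub> Y) =
      a \<odot>\<^bsub>quotient_module M H\<^esub> X \<oplus>\<^bsub>quotient_module M H\<^esub> a \<odot>\<^bsub>quotient_module M H\<^esub> Y"
    by (auto simp: quotient_carrier quotient_smult quotient_add M.smult_r_distr)
next
  fix X assume "X \<in> carrier (quotient_module M H)"
  then show "\<one>\<^bsub>R\<^esub> \<odot>\<^bsub>quotient_module M H\<^esub> X = X"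
    by (auto simp: quotient_carrier quotient_smult)
qed (rule M.R.is_cring)

lemma quotient_proj_linear: "(\<lambda>x. H +>\<^bsub>M\<^esub> x) \<in> linear_maps R M (quotient_module M H)"
  by (intro linear_mapsI) (auto simp: quotient_carrier quotient_add quotient_smult)

lemma quotient_proj_eq_zero: "x \<in> H \<Longrightarrow> H +>\<^bsub>M\<^esub> x = \<zero>\<^bsub>quotient_module M H\<^esub>"
  using M.M.a_coset_join2[OF _ HS.a_subgroup, of x] HS.a_subset
  by (auto simp: quotient_module_def)

lemma quotient_universal:
  assumes P: "module R P" and f: "f \<in> linear_maps R M P" and kernel: "\<And>x. x \<in> H \<Longrightarrow> f x = \<zero>\<^bsub>P\<^esub>"
  obtains h where "h \<in> linear_maps R (quotient_module M H) P"
    "\<And>x. x \<in> carrier M \<Longrightarrow> h (H +>\<^bsub>M\<^esub> x) = f x"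
proof -
  interpret P: module R P by fact
  define h where "h X = f (SOME x. x \<in> X)" for X
  have h: "h (H +>\<^bsub>M\<^esub> x) = f x" if x: "x \<in> carrier M" for x
  proof -
    have "(SOME y. y \<in> H +>\<^bsub>M\<^esub> x) \<in> H +>\<^bsub>M\<^esub> x"
      using HS.a_rcos_self[OF x] by (rule someI)
    then obtain k where "k \<in> H" "(SOME y. y \<in> H +>\<^bsub>M\<^esub> x) = k \<oplus>\<^bsub>M\<^esub> x"
      using coset_mem_iff[OF x] by auto
    moreover from this have "k \<in> carrier M" using HS.a_subset by auto
    ultimately show ?thesis
      using x by (simp add: h_def linear_add[OF f] kernel linear_closed[OF f])
  qed
  have "h \<in> linear_maps R (quotient_module M H) P"
    by (intro linear_mapsI)
      (auto simp: quotient_carrier quotient_add quotient_smult h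
        linear_closed[OF f] linear_add[OF f] linear_smult[OF f])
  then show ?thesis using h that by blast
qed

end


section \<open>Tensor products\<close>

text \<open>The generators of the module of tensor relations, without the span: a linear map kills all relations as
soon as it kills these.\<close>

definition bilinearity_relators where
  "bilinearity_relators R M N = (let F = free_module R (carrier M \<times> carrier N); e = free_gen R in
       ({e (m \<oplus>\<^bsub>M\<^esub> m', n) \<ominus>\<^bsub>F\<^esub> (e (m, n) \<oplus>\<^bsub>F\<^esub> e (m', n)) | m m' n.
           m \<in> carrier M \<and> m' \<in> carrier M \<and> n \<in> carrier N} \<union>
        {e (m, n \<oplus>\<^bsub>N\<^esub> n') \<ominus>\<^bsub>F\<^esub> (e (m, n) \<oplus>\<^bsub>F\<^esub> e (m, n')) | m n n'.
           m \<in> carrier M \<and> n \<in> carrier N \<and> n' \<in> carrier N} \<union>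
        {e (a \<odot>\<^bsub>M\<^esub> m, n) \<ominus>\<^bsub>F\<^esub> a \<odot>\<^bsub>F\<^esub> e (m, n) | a m n.
           a \<in> carrier R \<and> m \<in> carrier M \<and> n \<in> carrier N} \<union>
        {e (m, a \<odot>\<^bsub>N\<^esub> n) \<ominus>\<^bsub>F\<^esub> a \<odot>\<^bsub>F\<^esub> e (m, n) | a m n.
           a \<in> carrier R \<and> m \<in> carrier M \<and> n \<in> carrier N}))"

lemma tensor_relations_span:
  "tensor_relations R M N =
    submodule_span R (free_module R (carrier M \<times> carrier N)) (bilinearity_relators R M N)"
  unfolding tensor_relations_def bilinearity_relators_def Let_def ..

lemma ball_bilinearity_relators:
  fixes R M N
  defines "F \<equiv> free_module R (carrier M \<times> carrier N)"
  shows "(\<forall>x\<in>bilinearity_relators R M N. Q x) \<longleftrightarrow>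
    (\<forall>m\<in>carrier M. \<forall>m'\<in>carrier M. \<forall>n\<in>carrier N.
       Q (free_gen R (m \<oplus>\<^bsub>M\<^esub> m', n) \<ominus>\<^bsub>F\<^esub> (free_gen R (m, n) \<oplus>\<^bsub>F\<^esub> free_gen R (m', n)))) \<and>
    (\<forall>m\<in>carrier M. \<forall>n\<in>carrier N. \<forall>n'\<in>carrier N.
       Q (free_gen R (m, n \<oplus>\<^bsub>N\<^esub> n') \<ominus>\<^bsub>F\<^esub> (free_gen R (m, n) \<oplus>\<^bsub>F\<^esub> free_gen R (m, n')))) \<and>
    (\<forall>a\<in>carrier R. \<forall>m\<in>carrier M. \<forall>n\<in>carrier N.
       Q (free_gen R (a \<odot>\<^bsub>M\<^esub> m, n) \<ominus>\<^bsub>F\<^esub> a \<odot>\<^bsub>F\<^esub> free_gen R (m, n))) \<and>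
    (\<forall>a\<in>carrier R. \<forall>m\<in>carrier M. \<forall>n\<in>carrier N.
       Q (free_gen R (m, a \<odot>\<^bsub>N\<^esub> n) \<ominus>\<^bsub>F\<^esub> a \<odot>\<^bsub>F\<^esub> free_gen R (m, n)))"
  unfolding bilinearity_relators_def Let_def F_def[symmetric] ball_Un conj_assoc
  by (intro arg_cong2[where f = "(\<and>)"]; blast)

lemma bilinear_mapsI:
  assumes "\<And>n. n \<in> carrier N \<Longrightarrow> (\<lambda>m. f m n) \<in> linear_maps R M P"
    and "\<And>m. m \<in> carrier M \<Longrightarrow> (\<lambda>n. f m n) \<in> linear_maps R N P"
  shows "f \<in> bilinear_maps R M N P"
  using assms by (simp add: bilinear_maps_def)

lemma bilinear_left: "f \<in> bilinear_maps R M N P \<Longrightarrow> n \<in> carrier N \<Longrightarrow> (\<lambda>m. f m n) \<in> linear_maps R M P"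
  by (simp add: bilinear_maps_def)

lemma bilinear_right: "f \<in> bilinear_maps R M N P \<Longrightarrow> m \<in> carrier M \<Longrightarrow> (\<lambda>n. f m n) \<in> linear_maps R N P"
  by (simp add: bilinear_maps_def)

lemma diff_eq_zero:
  assumes "module R P" "x \<in> carrier P" "y \<in> carrier P"
  shows "x \<ominus>\<^bsub>P\<^esub> y = \<zero>\<^bsub>P\<^esub> \<longleftrightarrow> x = y"
proof -
  interpret P: module R P by fact
  show ?thesis
    using assms(2,3) by (metis P.M.a_assoc P.M.a_inv_closed P.M.l_neg P.M.l_zero P.M.r_neg P.M.r_zero a_minus_def)
qed

text \<open>Each relator is the defect of one instance of additivity or homogeneity of \<open>(m, n) \<mapsto> e (m, n)\<close>. Read
from left to right this makes \<open>pure_tensor\<close> bilinear, read from right to left it lets a bilinear map descend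
to the tensor product.\<close>

lemma bilinearity_relators_kernel:
  assumes M: "module R M" and N: "module R N" and P: "module R P"
    and h: "h \<in> linear_maps R (free_module R (carrier M \<times> carrier N)) P"
  shows "(\<forall>x\<in>bilinearity_relators R M N. h x = \<zero>\<^bsub>P\<^esub>) \<longleftrightarrow>
    (\<lambda>m n. h (free_gen R (m, n))) \<in> bilinear_maps R M N P"
proof -
  interpret M: module R M by fact
  interpret N: module R N by fact
  interpret P: module R P by fact
  let ?F = "free_module R (carrier M \<times> carrier N)"
  let ?e = "\<lambda>m n. free_gen R (m, n)"
  have F: "module R ?F" by (rule M.R.free_module_is_module)
  interpret F: module R ?F by (rule F)
  have e: "?e m n \<in> carrier ?F" if "m \<in> carrier M" "n \<in> carrier N" for m n
    using that by (intro M.R.free_gen_closed) auto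
  have kernel: "h (x \<ominus>\<^bsub>?F\<^esub> y) = \<zero>\<^bsub>P\<^esub> \<longleftrightarrow> h x = h y" if "x \<in> carrier ?F" "y \<in> carrier ?F" for x y
    using that linear_closed[OF h] diff_eq_zero[OF P] by (simp add: linear_minus[OF h F P])
  note [simp del] = free_module_simps
  have sums: "h (x \<oplus>\<^bsub>?F\<^esub> y) = h x \<oplus>\<^bsub>P\<^esub> h y" if "x \<in> carrier ?F" "y \<in> carrier ?F" for x y
    using that by (rule linear_add[OF h])
  have smults: "h (a \<odot>\<^bsub>?F\<^esub> x) = a \<odot>\<^bsub>P\<^esub> h x" if "a \<in> carrier R" "x \<in> carrier ?F" for x a
    using that by (rule linear_smult[OF h])
  have "(\<forall>x\<in>bilinearity_relators R M N. h x = \<zero>\<^bsub>P\<^esub>) \<longleftrightarrow>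
    (\<forall>m\<in>carrier M. \<forall>m'\<in>carrier M. \<forall>n\<in>carrier N. h (?e (m \<oplus>\<^bsub>M\<^esub> m') n) = h (?e m n) \<oplus>\<^bsub>P\<^esub> h (?e m' n)) \<and>
    (\<forall>m\<in>carrier M. \<forall>n\<in>carrier N. \<forall>n'\<in>carrier N. h (?e m (n \<oplus>\<^bsub>N\<^esub> n')) = h (?e m n) \<oplus>\<^bsub>P\<^esub> h (?e m n')) \<and>
    (\<forall>a\<in>carrier R. \<forall>m\<in>carrier M. \<forall>n\<in>carrier N. h (?e (a \<odot>\<^bsub>M\<^esub> m) n) = a \<odot>\<^bsub>P\<^esub> h (?e m n)) \<and>
    (\<forall>a\<in>carrier R. \<forall>m\<in>carrier M. \<forall>n\<in>carrier N. h (?e m (a \<odot>\<^bsub>N\<^esub> n)) = a \<odot>\<^bsub>P\<^esub> h (?e m n))"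
    by (simp add: ball_bilinearity_relators kernel e sums smults)
  also have "\<dots> \<longleftrightarrow> (\<lambda>m n. h (?e m n)) \<in> bilinear_maps R M N P"
    using linear_closed[OF h e] unfolding bilinear_maps_def linear_maps_def by auto
  finally show ?thesis .
qed

lemma bilinearity_relators_subset:
  assumes M: "module R M" and N: "module R N"
  shows "bilinearity_relators R M N \<subseteq> carrier (free_module R (carrier M \<times> carrier N))"
proof -
  interpret M: module R M by fact
  interpret N: module R N by fact
  let ?F = "free_module R (carrier M \<times> carrier N)"
  interpret F: module R ?F by (rule M.R.free_module_is_module)
  have e: "free_gen R (m, n) \<in> carrier ?F" if "m \<in> carrier M" "n \<in> carrier N" for m n
    using that by (intro M.R.free_gen_closed) auto
  note [simp del] = free_module_simps
  have "\<forall>x\<in>bilinearity_relators R M N. x \<in> carrier ?F"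
    by (simp add: ball_bilinearity_relators e)
  then show ?thesis by blast
qed

context
  fixes R :: "('k, 'r) ring_scheme" and M :: "('k, 'a, 'x) module_scheme"
    and N :: "('k, 'b, 'y) module_scheme"
  assumes M: "module R M" and N: "module R N"
begin

interpretation M: module R M by (rule M)
interpretation N: module R N by (rule N)

private abbreviation "F \<equiv> free_module R (carrier M \<times> carrier N)"

private lemma F: "module R F" by (rule M.R.free_module_is_module)

private lemma relations_submodule: "submodule (tensor_relations R M N) R F"
  unfolding tensor_relations_span
  by (intro submodule_span_submodule F bilinearity_relators_subset M N)

lemma tensor_module: "module R (tensor R M N)"
  unfolding tensor_def by (intro quotient_module_is_module F relations_submodule)

private lemma proj_linear:
  "(\<lambda>\<phi>. tensor_relations R M N +>\<^bsub>F\<^esub> \<phi>) \<in> linear_maps R F (tensor R M N)"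
  unfolding tensor_def by (intro quotient_proj_linear F relations_submodule)

lemma pure_tensor_bilinear: "pure_tensor R M N \<in> bilinear_maps R M N (tensor R M N)"
proof -
  have "bilinearity_relators R M N \<subseteq> tensor_relations R M N"
    unfolding tensor_relations_span
    by (intro submodule_span_submodule F bilinearity_relators_subset M N)
  then have "\<forall>x\<in>bilinearity_relators R M N. tensor_relations R M N +>\<^bsub>F\<^esub> x = \<zero>\<^bsub>tensor R M N\<^esub>"
    unfolding tensor_def using quotient_proj_eq_zero[OF F relations_submodule] by blast
  then show ?thesis
    unfolding bilinearity_relators_kernel[OF M N tensor_module proj_linear]
    by (simp add: pure_tensor_def[abs_def])
qed

lemma pure_tensor_closed:
  "m \<in> carrier M \<Longrightarrow> n \<in> carrier N \<Longrightarrow> pure_tensor R M N m n \<in> carrier (tensor R M N)"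
  by (rule linear_closed[OF bilinear_right[OF pure_tensor_bilinear]])

text \<open>Scalars and the zero tensor need no cases of their own: a multiple of a pure tensor is pure, and \<open>0\<close> is
\<open>0 \<otimes> 0\<close>.\<close>

lemma tensor_induct [consumes 1, case_names pure add]:
  assumes x: "x \<in> carrier (tensor R M N)"
    and pure: "\<And>m n. m \<in> carrier M \<Longrightarrow> n \<in> carrier N \<Longrightarrow> Q (pure_tensor R M N m n)"
    and add: "\<And>x y. x \<in> carrier (tensor R M N) \<Longrightarrow> Q x \<Longrightarrow> y \<in> carrier (tensor R M N) \<Longrightarrow> Q y \<Longrightarrow>
      Q (x \<oplus>\<^bsub>tensor R M N\<^esub> y)"
  shows "Q x"
proof -
  interpret F: module R F by (rule F)
  let ?p = "\<lambda>\<phi>. tensor_relations R M N +>\<^bsub>F\<^esub> \<phi>"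
  have "Q (?p \<phi>)" if "\<phi> \<in> carrier F" for \<phi>
    using that
  proof (induction rule: M.R.free_module_induct)
    case zero
    have "?p (\<lambda>x. \<zero>\<^bsub>R\<^esub>) = \<zero>\<^bsub>tensor R M N\<^esub>"
      using linear_zero[OF proj_linear F tensor_module] by simp
    also have "\<dots> = pure_tensor R M N \<zero>\<^bsub>M\<^esub> \<zero>\<^bsub>N\<^esub>"
      by (rule linear_zero[OF bilinear_right[OF pure_tensor_bilinear] N tensor_module, symmetric]) simp
    finally show ?case by (simp add: pure)
  next
    case (add \<phi> a z)
    then obtain m n where z: "z = (m, n)" "m \<in> carrier M" "n \<in> carrier N" by auto
    have e: "free_gen R z \<in> carrier F" using add by (intro M.R.free_gen_closed)
    have "?p (a \<odot>\<^bsub>F\<^esub> free_gen R z) = a \<odot>\<^bsub>tensor R M N\<^esub> pure_tensor R M N m n"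
      using linear_smult[OF proj_linear \<open>a \<in> carrier R\<close> e] by (simp add: z pure_tensor_def)
    also have "\<dots> = pure_tensor R M N (a \<odot>\<^bsub>M\<^esub> m) n"
      using linear_smult[OF bilinear_left[OF pure_tensor_bilinear]] add z by simp
    finally have "?p (a \<odot>\<^bsub>F\<^esub> free_gen R z) = pure_tensor R M N (a \<odot>\<^bsub>M\<^esub> m) n" .
    then have "?p (\<phi> \<oplus>\<^bsub>F\<^esub> a \<odot>\<^bsub>F\<^esub> free_gen R z) = ?p \<phi> \<oplus>\<^bsub>tensor R M N\<^esub> pure_tensor R M N (a \<odot>\<^bsub>M\<^esub> m) n"
      using linear_add[OF proj_linear add.hyps(1) F.smult_closed[OF add.hyps(2) e]] by simp
    moreover have "Q (?p \<phi> \<oplus>\<^bsub>tensor R M N\<^esub> pure_tensor R M N (a \<odot>\<^bsub>M\<^esub> m) n)"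
      using add z linear_closed[OF proj_linear] by (intro assms(3) pure pure_tensor_closed) auto
    ultimately show ?case by simp
  qed
  then show ?thesis
    using x quotient_carrier[OF F relations_submodule] unfolding tensor_def by auto
qed

lemma tensor_ext:
  assumes "f \<in> linear_maps R (tensor R M N) P" "g \<in> linear_maps R (tensor R M N) P"
    and "\<And>m n. m \<in> carrier M \<Longrightarrow> n \<in> carrier N \<Longrightarrow> f (pure_tensor R M N m n) = g (pure_tensor R M N m n)"
    and "x \<in> carrier (tensor R M N)"
  shows "f x = g x"
  using assms(4)
  by (induction rule: tensor_induct) (simp_all add: assms(3) linear_add[OF assms(1)] linear_add[OF assms(2)])

lemma tensor_universal:
  assumes P: "module R P" and f: "f \<in> bilinear_maps R M N P"
  obtains h where "h \<in> linear_maps R (tensor R M N) P"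
    "\<And>m n. m \<in> carrier M \<Longrightarrow> n \<in> carrier N \<Longrightarrow> h (pure_tensor R M N m n) = f m n"
proof -
  have closed: "f m n \<in> carrier P" if "m \<in> carrier M" "n \<in> carrier N" for m n
    by (rule linear_closed[OF bilinear_left[OF f that(2)] that(1)])
  obtain h0 where h0: "h0 \<in> linear_maps R F P"
    "\<And>z. z \<in> carrier M \<times> carrier N \<Longrightarrow> h0 (free_gen R z) = case_prod f z"
    using free_module_universal[OF P, of "carrier M \<times> carrier N" "case_prod f"] closed by auto
  have "(\<lambda>m n. h0 (free_gen R (m, n))) \<in> bilinear_maps R M N P"
  proof (rule bilinear_mapsI)
    show "(\<lambda>m. h0 (free_gen R (m, n))) \<in> linear_maps R M P" if "n \<in> carrier N" for n
      using that h0(2) by (intro linear_cong[OF bilinear_left[OF f that] _ M]) auto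
    show "(\<lambda>n. h0 (free_gen R (m, n))) \<in> linear_maps R N P" if "m \<in> carrier M" for m
      using that h0(2) by (intro linear_cong[OF bilinear_right[OF f that] _ N]) auto
  qed
  then have "\<forall>x\<in>bilinearity_relators R M N. h0 x = \<zero>\<^bsub>P\<^esub>"
    using bilinearity_relators_kernel[OF M N P h0(1)] by simp
  then have "tensor_relations R M N \<subseteq> {x \<in> carrier F. h0 x = \<zero>\<^bsub>P\<^esub>}"
    unfolding tensor_relations_span using bilinearity_relators_subset[OF M N]
    by (intro submodule_span_least linear_kernel_submodule[OF h0(1) F P]) auto
  then obtain h where h: "h \<in> linear_maps R (tensor R M N) P"
    "\<And>\<phi>. \<phi> \<in> carrier F \<Longrightarrow> h (tensor_relations R M N +>\<^bsub>F\<^esub> \<phi>) = h0 \<phi>"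
    using quotient_universal[OF F relations_submodule P h0(1)] unfolding tensor_def by blast
  have "h (pure_tensor R M N m n) = f m n" if "m \<in> carrier M" "n \<in> carrier N" for m n
    using that h(2)[OF M.R.free_gen_closed, of "(m, n)"] h0(2)[of "(m, n)"] by (simp add: pure_tensor_def)
  with h(1) show ?thesis using that by blast
qed

text \<open>The description of \<open>tensor_lift\<close> determines a unique function: a linear map is determined on the carrier by
its values on pure tensors, and extensionality fixes it elsewhere.\<close>

lemma tensor_lift:
  assumes P: "module R P" and f: "f \<in> bilinear_maps R M N P"
  shows tensor_lift_linear: "tensor_lift R M N P f \<in> linear_maps R (tensor R M N) P"
    and tensor_lift_pure: "m \<in> carrier M \<Longrightarrow> n \<in> carrier N \<Longrightarrow>
      tensor_lift R M N P f (pure_tensor R M N m n) = f m n"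
proof -
  let ?C = "carrier (tensor R M N)"
  let ?S = "\<lambda>h. h \<in> linear_maps R (tensor R M N) P \<and> h \<in> extensional ?C \<and>
     (\<forall>m\<in>carrier M. \<forall>n\<in>carrier N. h (pure_tensor R M N m n) = f m n)"
  obtain h where h: "h \<in> linear_maps R (tensor R M N) P"
    "\<And>m n. m \<in> carrier M \<Longrightarrow> n \<in> carrier N \<Longrightarrow> h (pure_tensor R M N m n) = f m n"
    using tensor_universal[OF P f] by blast
  have "?S (restrict h ?C)"
    using h linear_cong[OF h(1) _ tensor_module, of "restrict h ?C"] pure_tensor_closed by auto
  moreover have "g = restrict h ?C" if "?S g" for g
  proof (rule extensionalityI)
    show "g \<in> extensional ?C" using that by blast
    show "restrict h ?C \<in> extensional ?C" by simp
    show "g x = restrict h ?C x" if "x \<in> ?C" for x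
      using tensor_ext[of g P h x] \<open>?S g\<close> h that by simp
  qed
  ultimately have "?S (tensor_lift R M N P f)"
    unfolding tensor_lift_def by (rule theI)
  then show "tensor_lift R M N P f \<in> linear_maps R (tensor R M N) P"
    "m \<in> carrier M \<Longrightarrow> n \<in> carrier N \<Longrightarrow> tensor_lift R M N P f (pure_tensor R M N m n) = f m n"
    by blast+
qed

text \<open>For a family of bilinear maps depending linearly on \<open>x\<close>, the induced linear map at a fixed tensor \<open>t\<close> also
depends linearly on \<open>x\<close>: this is clear for pure \<open>t\<close> and stable under sums. Lifts in one tensor can thus be
nested inside lifts in another.\<close>

lemma tensor_lift_linear_in_parameter:
  assumes P: "module R P" and L: "module R L"
    and bilinear: "\<And>x. x \<in> carrier L \<Longrightarrow> f x \<in> bilinear_maps R M N P"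
    and linear: "\<And>m n. m \<in> carrier M \<Longrightarrow> n \<in> carrier N \<Longrightarrow> (\<lambda>x. f x m n) \<in> linear_maps R L P"
    and t: "t \<in> carrier (tensor R M N)"
  shows "(\<lambda>x. tensor_lift R M N P (f x) t) \<in> linear_maps R L P"
  using t
proof (induction rule: tensor_induct)
  case (pure m n)
  then show ?case
    by (intro linear_cong[OF linear[OF pure] _ L]) (simp add: tensor_lift_pure P bilinear)
next
  case (add s t)
  show ?case
    by (rule linear_cong[OF linear_plus[OF add.IH P] _ L])
      (use add linear_add[OF tensor_lift_linear[OF P bilinear]] in simp)
qed

end

lemma linear_pure_left:
  assumes "f \<in> linear_maps R A M" "n \<in> carrier N" "module R M" "module R N"
  shows "(\<lambda>x. pure_tensor R M N (f x) n) \<in> linear_maps R A (tensor R M N)"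
  by (rule linear_comp[OF assms(1) bilinear_left[OF pure_tensor_bilinear[OF assms(3,4)] assms(2)]])

lemma linear_pure_right:
  assumes "f \<in> linear_maps R A N" "m \<in> carrier M" "module R M" "module R N"
  shows "(\<lambda>x. pure_tensor R M N m (f x)) \<in> linear_maps R A (tensor R M N)"
  by (rule linear_comp[OF assms(1) bilinear_right[OF pure_tensor_bilinear[OF assms(3,4)] assms(2)]])

lemma tensor_map:
  assumes f: "f \<in> linear_maps R M M'" and g: "g \<in> linear_maps R N N'"
    and M: "module R M" and N: "module R N" and M': "module R M'" and N': "module R N'"
  shows tensor_map_linear: "tensor_map R M N M' N' f g \<in> linear_maps R (tensor R M N) (tensor R M' N')"
    and tensor_map_pure: "m \<in> carrier M \<Longrightarrow> n \<in> carrier N \<Longrightarrow>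
      tensor_map R M N M' N' f g (pure_tensor R M N m n) = pure_tensor R M' N' (f m) (g n)"
proof -
  have "(\<lambda>m n. pure_tensor R M' N' (f m) (g n)) \<in> bilinear_maps R M N (tensor R M' N')"
    by (intro bilinear_mapsI linear_pure_left linear_pure_right f g M' N' linear_closed[OF f]
        linear_closed[OF g])
  from tensor_lift[OF M N tensor_module[OF M' N'] this]
  show "tensor_map R M N M' N' f g \<in> linear_maps R (tensor R M N) (tensor R M' N')"
    "m \<in> carrier M \<Longrightarrow> n \<in> carrier N \<Longrightarrow>
      tensor_map R M N M' N' f g (pure_tensor R M N m n) = pure_tensor R M' N' (f m) (g n)"
    unfolding tensor_map_def by auto
qed

lemma tensor_assoc:
  assumes A: "module R A" and B: "module R B" and C: "module R C"
  shows tensor_assoc_linear: "tensor_assoc R A B C \<in>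
      linear_maps R (tensor R (tensor R A B) C) (tensor R A (tensor R B C))"
    and tensor_assoc_pure: "a \<in> carrier A \<Longrightarrow> b \<in> carrier B \<Longrightarrow> c \<in> carrier C \<Longrightarrow>
      tensor_assoc R A B C (pure_tensor R (tensor R A B) C (pure_tensor R A B a b) c) =
      pure_tensor R A (tensor R B C) a (pure_tensor R B C b c)"
proof -
  note mods = A B C tensor_module
  let ?f = "\<lambda>c a b. pure_tensor R A (tensor R B C) a (pure_tensor R B C b c)"
  let ?T = "tensor R A (tensor R B C)"
  have f: "?f c \<in> bilinear_maps R A B ?T" if "c \<in> carrier C" for c
    by (intro bilinear_mapsI linear_pure_left linear_pure_right linear_id mods that pure_tensor_closed)
  have "(\<lambda>x c. tensor_lift R A B ?T (?f c) x) \<in> bilinear_maps R (tensor R A B) C ?T"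
    by (intro bilinear_mapsI tensor_lift_linear f mods tensor_lift_linear_in_parameter
        linear_pure_right linear_id)
  from tensor_lift[OF tensor_module[OF A B] C _ this]
  show "tensor_assoc R A B C \<in> linear_maps R (tensor R (tensor R A B) C) ?T"
    "a \<in> carrier A \<Longrightarrow> b \<in> carrier B \<Longrightarrow> c \<in> carrier C \<Longrightarrow>
      tensor_assoc R A B C (pure_tensor R (tensor R A B) C (pure_tensor R A B a b) c) = ?f c a b"
    unfolding tensor_assoc_def using tensor_lift_pure[OF A B _ f]
    by (simp_all add: mods pure_tensor_closed)
qed

lemma tensor_assoc_inv:
  assumes A: "module R A" and B: "module R B" and C: "module R C"
  shows tensor_assoc_inv_linear: "tensor_assoc_inv R A B C \<in>
      linear_maps R (tensor R A (tensor R B C)) (tensor R (tensor R A B) C)"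
    and tensor_assoc_inv_pure: "a \<in> carrier A \<Longrightarrow> b \<in> carrier B \<Longrightarrow> c \<in> carrier C \<Longrightarrow>
      tensor_assoc_inv R A B C (pure_tensor R A (tensor R B C) a (pure_tensor R B C b c)) =
      pure_tensor R (tensor R A B) C (pure_tensor R A B a b) c"
proof -
  note mods = A B C tensor_module
  let ?f = "\<lambda>a b c. pure_tensor R (tensor R A B) C (pure_tensor R A B a b) c"
  let ?T = "tensor R (tensor R A B) C"
  have f: "?f a \<in> bilinear_maps R B C ?T" if "a \<in> carrier A" for a
    by (intro bilinear_mapsI linear_pure_left linear_pure_right linear_id mods that pure_tensor_closed)
  have "(\<lambda>a y. tensor_lift R B C ?T (?f a) y) \<in> bilinear_maps R A (tensor R B C) ?T"
    by (intro bilinear_mapsI tensor_lift_linear f mods tensor_lift_linear_in_parameter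
        linear_pure_left linear_id)
  from tensor_lift[OF A tensor_module[OF B C] _ this]
  show "tensor_assoc_inv R A B C \<in> linear_maps R (tensor R A (tensor R B C)) ?T"
    "a \<in> carrier A \<Longrightarrow> b \<in> carrier B \<Longrightarrow> c \<in> carrier C \<Longrightarrow>
      tensor_assoc_inv R A B C (pure_tensor R A (tensor R B C) a (pure_tensor R B C b c)) = ?f a b c"
    unfolding tensor_assoc_inv_def using tensor_lift_pure[OF B C _ f]
    by (simp_all add: mods pure_tensor_closed)
qed

lemma tensor_left:
  assumes f: "f \<in> linear_maps R (tensor R A B) (tensor R B A)"
    and A: "module R A" and B: "module R B" and C: "module R C"
  shows tensor_left_linear: "tensor_left R A B C f \<in>
      linear_maps R (tensor R (tensor R A B) C) (tensor R (tensor R B A) C)"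
    and tensor_left_pure: "x \<in> carrier (tensor R A B) \<Longrightarrow> c \<in> carrier C \<Longrightarrow>
      tensor_left R A B C f (pure_tensor R (tensor R A B) C x c) = pure_tensor R (tensor R B A) C (f x) c"
  unfolding tensor_left_def
  by (intro tensor_map_linear tensor_map_pure f linear_id tensor_module A B C; assumption)+

lemma tensor_right:
  assumes f: "f \<in> linear_maps R (tensor R B C) (tensor R C B)"
    and A: "module R A" and B: "module R B" and C: "module R C"
  shows tensor_right_linear: "tensor_right R A B C f \<in>
      linear_maps R (tensor R (tensor R A B) C) (tensor R (tensor R A C) B)"
    and tensor_right_pure: "a \<in> carrier A \<Longrightarrow> b \<in> carrier B \<Longrightarrow> c \<in> carrier C \<Longrightarrow>
      tensor_right R A B C f (pure_tensor R (tensor R A B) C (pure_tensor R A B a b) c) =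
      tensor_assoc_inv R A C B (pure_tensor R A (tensor R C B) a (f (pure_tensor R B C b c)))"
proof -
  note mods = A B C tensor_module
  have map: "tensor_map R A (tensor R B C) A (tensor R C B) (\<lambda>a. a) f
      \<in> linear_maps R (tensor R A (tensor R B C)) (tensor R A (tensor R C B))"
    by (intro tensor_map_linear f linear_id mods)
  show "tensor_right R A B C f \<in> linear_maps R (tensor R (tensor R A B) C) (tensor R (tensor R A C) B)"
    unfolding tensor_right_def comp_def
    by (rule linear_comp[OF linear_comp[OF tensor_assoc_linear[OF A B C] map]
          tensor_assoc_inv_linear[OF A C B]])
  show "tensor_right R A B C f (pure_tensor R (tensor R A B) C (pure_tensor R A B a b) c) =
      tensor_assoc_inv R A C B (pure_tensor R A (tensor R C B) a (f (pure_tensor R B C b c)))"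
    if "a \<in> carrier A" "b \<in> carrier B" "c \<in> carrier C"
    unfolding tensor_right_def using that
    by (simp add: tensor_assoc_pure tensor_map_pure[OF linear_id f] mods pure_tensor_closed)
qed


section \<open>The braiding\<close>

lemma tensor_map_linear_in_left:
  assumes f: "\<And>x. x \<in> carrier L \<Longrightarrow> f x \<in> linear_maps R M M'"
    and f': "\<And>m. m \<in> carrier M \<Longrightarrow> (\<lambda>x. f x m) \<in> linear_maps R L M'"
    and g: "g \<in> linear_maps R N N'" and t: "t \<in> carrier (tensor R M N)"
    and mods: "module R L" "module R M" "module R N" "module R M'" "module R N'"
  shows "(\<lambda>x. tensor_map R M N M' N' (f x) g t) \<in> linear_maps R L (tensor R M' N')"
  unfolding tensor_map_def
  by (intro tensor_lift_linear_in_parameter bilinear_mapsI linear_pure_left linear_pure_right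
      tensor_module mods f f' g t linear_closed[OF f] linear_closed[OF g])

lemma tensor_map_linear_in_right:
  assumes g: "\<And>x. x \<in> carrier L \<Longrightarrow> g x \<in> linear_maps R N N'"
    and g': "\<And>n. n \<in> carrier N \<Longrightarrow> (\<lambda>x. g x n) \<in> linear_maps R L N'"
    and f: "f \<in> linear_maps R M M'" and t: "t \<in> carrier (tensor R M N)"
    and mods: "module R L" "module R M" "module R N" "module R M'" "module R N'"
  shows "(\<lambda>x. tensor_map R M N M' N' f (g x) t) \<in> linear_maps R L (tensor R M' N')"
  unfolding tensor_map_def
  by (intro tensor_lift_linear_in_parameter bilinear_mapsI linear_pure_left linear_pure_right
      tensor_module mods f g' g t linear_closed[OF f] linear_closed[OF g])

lemma leibniz_braiding:
  assumes M: "module R M" and N: "module R N" and K: "module R K"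
    and act: "(\<lambda>m k. act m (\<pi> k)) \<in> bilinear_maps R M K M"
    and \<delta>: "\<delta> \<in> linear_maps R N (tensor R N K)"
  shows leibniz_braiding_linear:
      "leibniz_braiding R K \<pi> M act N \<delta> \<in> linear_maps R (tensor R M N) (tensor R N M)"
    and leibniz_braiding_pure: "m \<in> carrier M \<Longrightarrow> n \<in> carrier N \<Longrightarrow>
      leibniz_braiding R K \<pi> M act N \<delta> (pure_tensor R M N m n) =
      pure_tensor R N M n m \<oplus>\<^bsub>tensor R N M\<^esub>
        tensor_map R N K N M (\<lambda>n. n) (\<lambda>k. act m (\<pi> k)) (\<delta> n)"
proof -
  have "(\<lambda>m n. pure_tensor R N M n m \<oplus>\<^bsub>tensor R N M\<^esub>
      tensor_map R N K N M (\<lambda>n. n) (\<lambda>k. act m (\<pi> k)) (\<delta> n)) \<in> bilinear_maps R M N (tensor R N M)"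
  proof (rule bilinear_mapsI)
    fix n assume n: "n \<in> carrier N"
    show "(\<lambda>m. pure_tensor R N M n m \<oplus>\<^bsub>tensor R N M\<^esub>
      tensor_map R N K N M (\<lambda>n. n) (\<lambda>k. act m (\<pi> k)) (\<delta> n)) \<in> linear_maps R M (tensor R N M)"
      by (intro linear_plus linear_pure_right tensor_map_linear_in_right linear_id M N K n
          bilinear_left[OF act] bilinear_right[OF act] tensor_module linear_closed[OF \<delta>])
  next
    fix m assume m: "m \<in> carrier M"
    show "(\<lambda>n. pure_tensor R N M n m \<oplus>\<^bsub>tensor R N M\<^esub>
      tensor_map R N K N M (\<lambda>n. n) (\<lambda>k. act m (\<pi> k)) (\<delta> n)) \<in> linear_maps R N (tensor R N M)"
      by (intro linear_plus linear_pure_left linear_comp[OF \<delta>] tensor_map_linear linear_id M N K m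
          bilinear_right[OF act] tensor_module)
  qed
  from tensor_lift[OF M N tensor_module[OF N M] this]
  show "leibniz_braiding R K \<pi> M act N \<delta> \<in> linear_maps R (tensor R M N) (tensor R N M)"
    "m \<in> carrier M \<Longrightarrow> n \<in> carrier N \<Longrightarrow>
      leibniz_braiding R K \<pi> M act N \<delta> (pure_tensor R M N m n) =
      pure_tensor R N M n m \<oplus>\<^bsub>tensor R N M\<^esub>
        tensor_map R N K N M (\<lambda>n. n) (\<lambda>k. act m (\<pi> k)) (\<delta> n)"
    unfolding leibniz_braiding_def by auto
qed

text \<open>Any expression of \<open>\<delta> n\<close> as a finite sum of pure tensors may be used, because the second summand of the
braiding is a linear map applied to \<open>\<delta> n\<close>.\<close>

lemma leibniz_braiding_sweedler:
  assumes M: "module R M" and N: "module R N" and K: "module R K"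
    and act: "(\<lambda>m k. act m (\<pi> k)) \<in> bilinear_maps R M K M"
    and \<delta>: "\<delta> \<in> linear_maps R N (tensor R N K)"
    and mn: "m \<in> carrier M" "n \<in> carrier N"
    and S: "finite S" "n0 \<in> S \<rightarrow> carrier N" "n1 \<in> S \<rightarrow> carrier K"
    and \<delta>n: "\<delta> n = (\<Oplus>\<^bsub>tensor R N K\<^esub>s\<in>S. pure_tensor R N K (n0 s) (n1 s))"
  shows "leibniz_braiding R K \<pi> M act N \<delta> (pure_tensor R M N m n) =
    pure_tensor R N M n m \<oplus>\<^bsub>tensor R N M\<^esub>
      (\<Oplus>\<^bsub>tensor R N M\<^esub>s\<in>S. pure_tensor R N M (n0 s) (act m (\<pi> (n1 s))))"
proof -
  interpret T: module R "tensor R N M" by (rule tensor_module[OF N M])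
  let ?B = "tensor_map R N K N M (\<lambda>n. n) (\<lambda>k. act m (\<pi> k))"
  have B: "?B \<in> linear_maps R (tensor R N K) (tensor R N M)"
    by (intro tensor_map_linear linear_id bilinear_right[OF act] M N K mn)
  have "?B (\<delta> n) = (\<Oplus>\<^bsub>tensor R N M\<^esub>s\<in>S. ?B (pure_tensor R N K (n0 s) (n1 s)))"
    unfolding \<delta>n using S
    by (intro linear_finsum[OF B]) (auto intro!: tensor_module pure_tensor_closed M N K)
  also have "\<dots> = (\<Oplus>\<^bsub>tensor R N M\<^esub>s\<in>S. pure_tensor R N M (n0 s) (act m (\<pi> (n1 s))))"
    using S mn linear_closed[OF bilinear_right[OF act]]
    by (intro T.finsum_cong')
      (auto intro!: pure_tensor_closed M N simp: tensor_map_pure[OF linear_id bilinear_right[OF act]] M N K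
        Pi_iff)
  finally show ?thesis
    by (simp add: leibniz_braiding_pure[where act = act and \<pi> = \<pi>, OF M N K act \<delta> mn])
qed

text \<open>Moving \<open>p\<close> to the left across \<open>m\<close> and then across \<open>n\<close> would give a fourth term, in which the coaction of
\<open>p\<close> is used twice. It is the image of \<open>(\<delta> \<otimes> Id) (\<delta> p)\<close> under the linear map
\<open>(p \<otimes> k) \<otimes> l \<mapsto> (p \<otimes> n * k) \<otimes> m * l\<close> and therefore zero.\<close>

lemma braiding_past_two:
  assumes M: "module R M" and N: "module R N" and P: "module R P" and K: "module R K"
    and actM: "(\<lambda>m k. actM m (\<pi> k)) \<in> bilinear_maps R M K M"
    and actN: "(\<lambda>n k. actN n (\<pi> k)) \<in> bilinear_maps R N K N"
    and \<delta>: "\<delta> \<in> linear_maps R P (tensor R P K)"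
    and square_zero: "\<And>p. p \<in> carrier P \<Longrightarrow>
      tensor_map R P K (tensor R P K) K \<delta> (\<lambda>k. k) (\<delta> p) = \<zero>\<^bsub>tensor R (tensor R P K) K\<^esub>"
    and n: "n \<in> carrier N" and m: "m \<in> carrier M" and p: "p \<in> carrier P"
  shows "tensor_left R N P M (leibniz_braiding R K \<pi> N actN P \<delta>)
      (tensor_right R N M P (leibniz_braiding R K \<pi> M actM P \<delta>)
        (pure_tensor R (tensor R N M) P (pure_tensor R N M n m) p)) =
    pure_tensor R (tensor R P N) M (pure_tensor R P N p n) m \<oplus>\<^bsub>tensor R (tensor R P N) M\<^esub>
    pure_tensor R (tensor R P N) M
      (tensor_map R P K P N (\<lambda>p. p) (\<lambda>k. actN n (\<pi> k)) (\<delta> p)) m \<oplus>\<^bsub>tensor R (tensor R P N) M\<^esub>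
    tensor_map R P K (tensor R P N) M (\<lambda>p. pure_tensor R P N p n) (\<lambda>k. actM m (\<pi> k)) (\<delta> p)"
proof -
  note mods = M N P K tensor_module
  let ?T = "tensor R (tensor R P N) M"
  interpret T: module R ?T by (intro mods)
  let ?L = "tensor_left R N P M (leibniz_braiding R K \<pi> N actN P \<delta>)"
  have a: "(\<lambda>k. actM m (\<pi> k)) \<in> linear_maps R K M" by (rule bilinear_right[OF actM m])
  have b: "(\<lambda>k. actN n (\<pi> k)) \<in> linear_maps R K N" by (rule bilinear_right[OF actN n])
  let ?BM = "tensor_map R P K P M (\<lambda>p. p) (\<lambda>k. actM m (\<pi> k))"
  let ?BN = "tensor_map R P K P N (\<lambda>p. p) (\<lambda>k. actN n (\<pi> k))"
  let ?E = "tensor_map R P K (tensor R P N) M (\<lambda>p. pure_tensor R P N p n) (\<lambda>k. actM m (\<pi> k))"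
  let ?C = "tensor_map R (tensor R P K) K (tensor R P N) M ?BN (\<lambda>k. actM m (\<pi> k))"
  let ?D = "tensor_map R P K (tensor R P K) K \<delta> (\<lambda>k. k)"
  let ?A = "tensor_assoc_inv R N P M"
  have pn: "(\<lambda>p. pure_tensor R P N p n) \<in> linear_maps R P (tensor R P N)"
    by (intro linear_pure_left linear_id mods n)
  have BM: "?BM \<in> linear_maps R (tensor R P K) (tensor R P M)"
    by (intro tensor_map_linear linear_id a mods)
  have BN: "?BN \<in> linear_maps R (tensor R P K) (tensor R P N)"
    by (intro tensor_map_linear linear_id b mods)
  have E: "?E \<in> linear_maps R (tensor R P K) ?T"
    by (intro tensor_map_linear pn a mods)
  have C: "?C \<in> linear_maps R (tensor R (tensor R P K) K) ?T"
    by (intro tensor_map_linear BN a mods)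
  have D: "?D \<in> linear_maps R (tensor R P K) (tensor R (tensor R P K) K)"
    by (intro tensor_map_linear \<delta> linear_id mods)
  note brN = leibniz_braiding[where act = actN and \<pi> = \<pi>, OF N P K actN \<delta>]
  note brM = leibniz_braiding[where act = actM and \<pi> = \<pi>, OF M P K actM \<delta>]
  have L: "?L \<in> linear_maps R (tensor R (tensor R N P) M) ?T"
    by (intro tensor_left_linear brN mods)
  note L_pure = tensor_left_pure[OF brN(1) N P M]
  have A: "?A \<in> linear_maps R (tensor R N (tensor R P M)) (tensor R (tensor R N P) M)"
    by (intro tensor_assoc_inv_linear mods)
  have pure_n: "pure_tensor R N (tensor R P M) n \<in> linear_maps R (tensor R P M) (tensor R N (tensor R P M))"
    by (rule bilinear_right[OF pure_tensor_bilinear n]) (intro mods)+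
  have pure_m: "(\<lambda>x. pure_tensor R (tensor R P N) M x m) \<in> linear_maps R (tensor R P N) ?T"
    by (rule bilinear_left[OF pure_tensor_bilinear m]) (intro mods)+
  \<comment> \<open>The term in which \<open>m\<close> was acted on, carried through the second crossing. With a general tensor \<open>t\<close> in
    place of \<open>\<delta> p\<close> this is an identity of linear maps, so pure tensors suffice.\<close>
  have split: "?L (?A (pure_tensor R N (tensor R P M) n (?BM t))) = ?E t \<oplus>\<^bsub>?T\<^esub> ?C (?D t)"
    if "t \<in> carrier (tensor R P K)" for t
  proof (rule tensor_ext[OF P K _ _ _ that])
    show "(\<lambda>t. ?L (?A (pure_tensor R N (tensor R P M) n (?BM t)))) \<in> linear_maps R (tensor R P K) ?T"
      by (rule linear_comp[OF linear_comp[OF linear_comp[OF BM pure_n] A] L])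
    show "(\<lambda>t. ?E t \<oplus>\<^bsub>?T\<^esub> ?C (?D t)) \<in> linear_maps R (tensor R P K) ?T"
      by (intro linear_plus E linear_comp[OF D C] mods)
    fix p k assume pk: "p \<in> carrier P" "k \<in> carrier K"
    have mk: "actM m (\<pi> k) \<in> carrier M" by (rule linear_closed[OF a pk(2)])
    have pure_mk: "(\<lambda>x. pure_tensor R (tensor R P N) M x (actM m (\<pi> k))) \<in> linear_maps R (tensor R P N) ?T"
      by (rule bilinear_left[OF pure_tensor_bilinear mk]) (intro mods)+
    have "?L (?A (pure_tensor R N (tensor R P M) n (?BM (pure_tensor R P K p k)))) =
        ?L (pure_tensor R (tensor R N P) M (pure_tensor R N P n p) (actM m (\<pi> k)))"
      using pk by (simp add: tensor_map_pure[OF linear_id a] tensor_assoc_inv_pure mods n mk)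
    also have "\<dots> = pure_tensor R (tensor R P N) M
        (pure_tensor R P N p n \<oplus>\<^bsub>tensor R P N\<^esub> ?BN (\<delta> p)) (actM m (\<pi> k))"
      using pk by (simp add: L_pure brN(2) pure_tensor_closed mods n mk)
    also have "\<dots> = pure_tensor R (tensor R P N) M (pure_tensor R P N p n) (actM m (\<pi> k)) \<oplus>\<^bsub>?T\<^esub>
        pure_tensor R (tensor R P N) M (?BN (\<delta> p)) (actM m (\<pi> k))"
      using pk linear_closed[OF BN linear_closed[OF \<delta>]]
      by (intro linear_add[OF pure_mk]) (auto simp: pure_tensor_closed mods n)
    also have "\<dots> = ?E (pure_tensor R P K p k) \<oplus>\<^bsub>?T\<^esub> ?C (?D (pure_tensor R P K p k))"
      using pk linear_closed[OF \<delta>]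
      by (simp add: tensor_map_pure[OF pn a] tensor_map_pure[OF BN a] tensor_map_pure[OF \<delta> linear_id] mods)
    finally show "?L (?A (pure_tensor R N (tensor R P M) n (?BM (pure_tensor R P K p k)))) =
      ?E (pure_tensor R P K p k) \<oplus>\<^bsub>?T\<^esub> ?C (?D (pure_tensor R P K p k))" .
  qed
  have \<delta>p: "\<delta> p \<in> carrier (tensor R P K)" by (rule linear_closed[OF \<delta> p])
  have "tensor_right R N M P (leibniz_braiding R K \<pi> M actM P \<delta>)
        (pure_tensor R (tensor R N M) P (pure_tensor R N M n m) p) =
      ?A (pure_tensor R N (tensor R P M) n (pure_tensor R P M p m \<oplus>\<^bsub>tensor R P M\<^esub> ?BM (\<delta> p)))"
    using n m p by (simp add: tensor_right_pure[OF brM(1)] brM(2) mods)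
  also have "\<dots> = pure_tensor R (tensor R N P) M (pure_tensor R N P n p) m \<oplus>\<^bsub>tensor R (tensor R N P) M\<^esub>
      ?A (pure_tensor R N (tensor R P M) n (?BM (\<delta> p)))"
    using n m p \<delta>p linear_closed[OF BM] linear_closed[OF pure_n]
    by (simp add: linear_add[OF pure_n] linear_add[OF A] tensor_assoc_inv_pure pure_tensor_closed mods)
  finally have "?L (tensor_right R N M P (leibniz_braiding R K \<pi> M actM P \<delta>)
        (pure_tensor R (tensor R N M) P (pure_tensor R N M n m) p)) =
      ?L (pure_tensor R (tensor R N P) M (pure_tensor R N P n p) m) \<oplus>\<^bsub>?T\<^esub>
      ?L (?A (pure_tensor R N (tensor R P M) n (?BM (\<delta> p))))"
    using n m p \<delta>p linear_closed[OF BM] linear_closed[OF pure_n] linear_closed[OF A]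
    by (simp add: linear_add[OF L] pure_tensor_closed mods)
  also have "?L (pure_tensor R (tensor R N P) M (pure_tensor R N P n p) m) =
      pure_tensor R (tensor R P N) M (pure_tensor R P N p n) m \<oplus>\<^bsub>?T\<^esub>
      pure_tensor R (tensor R P N) M (?BN (\<delta> p)) m"
    using n m p \<delta>p linear_closed[OF BN]
    by (simp add: L_pure brN(2) pure_tensor_closed mods linear_add[OF pure_m])
  also have "?L (?A (pure_tensor R N (tensor R P M) n (?BM (\<delta> p)))) = ?E (\<delta> p)"
    using linear_closed[OF E \<delta>p]
    by (simp add: split[OF \<delta>p] square_zero[OF p] linear_zero[OF C] mods)
  finally show ?thesis .
qed


section \<open>The Yang-Baxter equation\<close>

text \<open>The last fact combines \<open>\<pi> (k \<cdot> g) = [\<pi> k, g]\<close> with the axiom of an action. It is the only link between the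
action of \<open>G\<close> on \<open>K\<close> and the order in which two elements of \<open>K\<close> act on \<open>M\<close>.\<close>

lemma crossed_module_representationD:
  assumes "crossed_module_representation R K G \<pi> cact M act \<delta>"
  shows "module R K" "module R G" "module R M" "\<pi> \<in> linear_maps R K G"
    "cact \<in> bilinear_maps R K G K" "act \<in> bilinear_maps R M G M"
    "\<delta> \<in> linear_maps R M (tensor R M K)"
    "\<And>m. m \<in> carrier M \<Longrightarrow>
      tensor_map R M K (tensor R M K) K \<delta> (\<lambda>k. k) (\<delta> m) = \<zero>\<^bsub>tensor R (tensor R M K) K\<^esub>"
    "\<And>m g. m \<in> carrier M \<Longrightarrow> g \<in> carrier G \<Longrightarrow> \<delta> (act m g) = tensor_act R M K act cact (\<delta> m) g"
    "(\<lambda>m k. act m (\<pi> k)) \<in> bilinear_maps R M K M"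
    "\<And>m k l. m \<in> carrier M \<Longrightarrow> k \<in> carrier K \<Longrightarrow> l \<in> carrier K \<Longrightarrow>
      act m (\<pi> (cact k (\<pi> l))) = act (act m (\<pi> k)) (\<pi> l) \<ominus>\<^bsub>M\<^esub> act (act m (\<pi> l)) (\<pi> k)"
proof -
  interpret crossed_module_representation R K G \<pi> cact M act \<delta> by fact
  show mods: "module R K" "module R G" "module R M"
    using leibniz_algebra.axioms(1)[OF K.leibniz_algebra_axioms]
      leibniz_algebra.axioms(1)[OF G.leibniz_algebra_axioms]
      crossed_module_representation.axioms(2)[OF assms] .
  show \<pi>: "\<pi> \<in> linear_maps R K G"
    using pi_morphism by (simp add: leibniz_morphisms_def)
  show "cact \<in> bilinear_maps R K G K" and act: "act \<in> bilinear_maps R M G M"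
    using cact_action act_action by (simp_all add: leibniz_actions_def)
  show "\<delta> \<in> linear_maps R M (tensor R M K)" by (rule delta_linear)
  show "tensor_map R M K (tensor R M K) K \<delta> (\<lambda>k. k) (\<delta> m) = \<zero>\<^bsub>tensor R (tensor R M K) K\<^esub>"
    if "m \<in> carrier M" for m by (rule delta_square_zero[OF that])
  show "\<delta> (act m g) = tensor_act R M K act cact (\<delta> m) g" if "m \<in> carrier M" "g \<in> carrier G" for m g
    by (rule delta_equivariant[OF that])
  show "(\<lambda>m k. act m (\<pi> k)) \<in> bilinear_maps R M K M"
    by (intro bilinear_mapsI bilinear_left[OF act] linear_comp[OF \<pi> bilinear_right[OF act]]
        linear_closed[OF \<pi>])
  show "act m (\<pi> (cact k (\<pi> l))) = act (act m (\<pi> k)) (\<pi> l) \<ominus>\<^bsub>M\<^esub> act (act m (\<pi> l)) (\<pi> k)"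
    if "m \<in> carrier M" "k \<in> carrier K" "l \<in> carrier K" for m k l
    using act_action that linear_closed[OF \<pi>] by (simp add: leibniz_actions_def pi_cact)
qed

text \<open>The three representations of one instance of the Yang-Baxter equation; elements \<open>m\<close>, \<open>n\<close>, \<open>p\<close> belong to
\<open>M\<close>, \<open>N\<close>, \<open>P\<close>, and \<open>u\<close>, \<open>t\<close> to \<open>N \<otimes> K\<close>, \<open>P \<otimes> K\<close>, where \<open>\<delta> n\<close> and \<open>\<delta> p\<close> live.\<close>

locale representation_triple =
  fixes R :: "('k, 'z) ring_scheme" and K :: "('k, 'a, 'x) leibniz_scheme"
    and G :: "('k, 'g, 'y) leibniz_scheme" and \<pi> :: "'a \<Rightarrow> 'g" and cact :: "'a \<Rightarrow> 'g \<Rightarrow> 'a"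
    and M :: "('k, 'm, 'u) module_scheme" and actM :: "'m \<Rightarrow> 'g \<Rightarrow> 'm"
    and \<delta>M :: "'m \<Rightarrow> ('m \<times> 'a \<Rightarrow> 'k) set"
    and N :: "('k, 'n, 'v) module_scheme" and actN :: "'n \<Rightarrow> 'g \<Rightarrow> 'n"
    and \<delta>N :: "'n \<Rightarrow> ('n \<times> 'a \<Rightarrow> 'k) set"
    and P :: "('k, 'p, 'w) module_scheme" and actP :: "'p \<Rightarrow> 'g \<Rightarrow> 'p"
    and \<delta>P :: "'p \<Rightarrow> ('p \<times> 'a \<Rightarrow> 'k) set"
  assumes M: "crossed_module_representation R K G \<pi> cact M actM \<delta>M"
    and N: "crossed_module_representation R K G \<pi> cact N actN \<delta>N"
    and P: "crossed_module_representation R K G \<pi> cact P actP \<delta>P"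
begin

lemmas repM = crossed_module_representationD[OF M]
lemmas repN = crossed_module_representationD[OF N]
lemmas repP = crossed_module_representationD[OF P]
lemmas mods = repM(1-3) repN(3) repP(3) tensor_module

definition actKM where "actKM m k = actM m (\<pi> k)"
definition actKN where "actKN n k = actN n (\<pi> k)"

lemma actKM_linear:
  "f \<in> linear_maps R A M \<Longrightarrow> k \<in> carrier K \<Longrightarrow> (\<lambda>x. actKM (f x) k) \<in> linear_maps R A M"
  "g \<in> linear_maps R A K \<Longrightarrow> m \<in> carrier M \<Longrightarrow> (\<lambda>x. actKM m (g x)) \<in> linear_maps R A M"
  unfolding actKM_def
  by (rule linear_comp[OF _ bilinear_left[OF repM(10)]] linear_comp[OF _ bilinear_right[OF repM(10)]];
      assumption)+

lemma actKN_linear: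
  "f \<in> linear_maps R A N \<Longrightarrow> k \<in> carrier K \<Longrightarrow> (\<lambda>x. actKN (f x) k) \<in> linear_maps R A N"
  "g \<in> linear_maps R A K \<Longrightarrow> n \<in> carrier N \<Longrightarrow> (\<lambda>x. actKN n (g x)) \<in> linear_maps R A N"
  unfolding actKN_def
  by (rule linear_comp[OF _ bilinear_left[OF repN(10)]] linear_comp[OF _ bilinear_right[OF repN(10)]];
      assumption)+

lemma actKM_closed: "m \<in> carrier M \<Longrightarrow> k \<in> carrier K \<Longrightarrow> actKM m k \<in> carrier M"
  by (rule linear_closed[OF actKM_linear(1)[OF linear_id]])

lemma actKN_closed: "n \<in> carrier N \<Longrightarrow> k \<in> carrier K \<Longrightarrow> actKN n k \<in> carrier N"
  by (rule linear_closed[OF actKN_linear(1)[OF linear_id]])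

abbreviation "T \<equiv> tensor R (tensor R P N) M"

text \<open>Linear maps replacing Sweedler expressions. The letters of a name list the tensor factors of the result: a
capital letter for the module of a variable factor, a small one for a fixed element; the last factor is
acted on by the \<open>K\<close>-part of the tensor. For \<open>t = p \<otimes> k\<close>, \<open>tw_PnM n m t\<close> is \<open>(p \<otimes> n) \<otimes> m * k\<close>, while for
\<open>u = n \<otimes> k\<close>, \<open>tw_pNM p m u\<close> is \<open>(p \<otimes> n) \<otimes> m * k\<close>.\<close>

definition tw_NM where "tw_NM m u = tensor_map R N K N M (\<lambda>n. n) (actKM m) u"
definition tw_PN where "tw_PN n t = tensor_map R P K P N (\<lambda>p. p) (actKN n) t"
definition tw_PM where "tw_PM m t = tensor_map R P K P M (\<lambda>p. p) (actKM m) t"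
definition tw_PnM where "tw_PnM n m t = tensor_map R P K (tensor R P N) M (\<lambda>p. pure_tensor R P N p n) (actKM m) t"
definition tw_PmN where "tw_PmN m n t = tensor_map R P K (tensor R P M) N (\<lambda>p. pure_tensor R P M p m) (actKN n) t"
definition tw_pNM where "tw_pNM p m u = tensor_map R N K (tensor R P N) M (\<lambda>n. pure_tensor R P N p n) (actKM m) u"

lemma tw_NM_linear:
  "f \<in> linear_maps R A (tensor R N K) \<Longrightarrow> m \<in> carrier M \<Longrightarrow> (\<lambda>x. tw_NM m (f x)) \<in> linear_maps R A (tensor R N M)"
  unfolding tw_NM_def
  by (rule linear_comp[OF _ tensor_map_linear]) (intro linear_id actKM_linear mods | assumption)+

lemma tw_PN_linear:
  "f \<in> linear_maps R A (tensor R P K) \<Longrightarrow> n \<in> carrier N \<Longrightarrow> (\<lambda>x. tw_PN n (f x)) \<in> linear_maps R A (tensor R P N)"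
  "g \<in> linear_maps R A N \<Longrightarrow> t \<in> carrier (tensor R P K) \<Longrightarrow> module R A \<Longrightarrow>
    (\<lambda>x. tw_PN (g x) t) \<in> linear_maps R A (tensor R P N)"
  unfolding tw_PN_def
   apply (rule linear_comp[OF _ tensor_map_linear]; (intro linear_id actKN_linear mods | assumption)+)
  apply (rule tensor_map_linear_in_right; (intro linear_id actKN_linear mods | erule linear_closed | assumption)+)
  done

lemma tw_PM_linear:
  "f \<in> linear_maps R A (tensor R P K) \<Longrightarrow> m \<in> carrier M \<Longrightarrow> (\<lambda>x. tw_PM m (f x)) \<in> linear_maps R A (tensor R P M)"
  unfolding tw_PM_def
  by (rule linear_comp[OF _ tensor_map_linear]) (intro linear_id actKM_linear mods | assumption)+

lemma tw_PmN_linear: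
  "f \<in> linear_maps R A (tensor R P K) \<Longrightarrow> m \<in> carrier M \<Longrightarrow> n \<in> carrier N \<Longrightarrow>
    (\<lambda>x. tw_PmN m n (f x)) \<in> linear_maps R A (tensor R (tensor R P M) N)"
  unfolding tw_PmN_def
  by (rule linear_comp[OF _ tensor_map_linear]) (intro linear_id actKN_linear mods linear_pure_left | assumption)+

lemma tw_PnM_linear:
  "f \<in> linear_maps R A (tensor R P K) \<Longrightarrow> n \<in> carrier N \<Longrightarrow> m \<in> carrier M \<Longrightarrow>
    (\<lambda>x. tw_PnM n m (f x)) \<in> linear_maps R A T"
  "g \<in> linear_maps R A M \<Longrightarrow> n \<in> carrier N \<Longrightarrow> t \<in> carrier (tensor R P K) \<Longrightarrow> module R A \<Longrightarrow>
    (\<lambda>x. tw_PnM n (g x) t) \<in> linear_maps R A T"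
  "h \<in> linear_maps R A N \<Longrightarrow> m \<in> carrier M \<Longrightarrow> t \<in> carrier (tensor R P K) \<Longrightarrow> module R A \<Longrightarrow>
    (\<lambda>x. tw_PnM (h x) m t) \<in> linear_maps R A T"
  unfolding tw_PnM_def
    apply (rule linear_comp[OF _ tensor_map_linear];
      (intro linear_id actKM_linear mods linear_pure_left | assumption)+)
   apply (rule tensor_map_linear_in_right;
      (intro linear_id actKM_linear mods linear_pure_left | erule linear_closed | assumption)+)
  apply (rule tensor_map_linear_in_left;
      (intro linear_id actKM_linear mods linear_pure_left linear_pure_right | erule linear_closed | assumption)+)
  done

lemma tw_pNM_linear:
  "f \<in> linear_maps R A (tensor R N K) \<Longrightarrow> p \<in> carrier P \<Longrightarrow> m \<in> carrier M \<Longrightarrow>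
    (\<lambda>x. tw_pNM p m (f x)) \<in> linear_maps R A T"
  "g \<in> linear_maps R A M \<Longrightarrow> p \<in> carrier P \<Longrightarrow> u \<in> carrier (tensor R N K) \<Longrightarrow> module R A \<Longrightarrow>
    (\<lambda>x. tw_pNM p (g x) u) \<in> linear_maps R A T"
  "h \<in> linear_maps R A P \<Longrightarrow> m \<in> carrier M \<Longrightarrow> u \<in> carrier (tensor R N K) \<Longrightarrow> module R A \<Longrightarrow>
    (\<lambda>x. tw_pNM (h x) m u) \<in> linear_maps R A T"
  unfolding tw_pNM_def
    apply (rule linear_comp[OF _ tensor_map_linear];
      (intro linear_id actKM_linear mods linear_pure_right | assumption)+)
   apply (rule tensor_map_linear_in_right;
      (intro linear_id actKM_linear mods linear_pure_right | erule linear_closed | assumption)+)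
  apply (rule tensor_map_linear_in_left;
      (intro linear_id actKM_linear mods linear_pure_left linear_pure_right | erule linear_closed | assumption)+)
  done

lemma tw_pure:
  assumes "m \<in> carrier M" "n \<in> carrier N" "p \<in> carrier P" "k \<in> carrier K"
  shows "tw_NM m (pure_tensor R N K n k) = pure_tensor R N M n (actKM m k)"
    "tw_PN n (pure_tensor R P K p k) = pure_tensor R P N p (actKN n k)"
    "tw_PM m (pure_tensor R P K p k) = pure_tensor R P M p (actKM m k)"
    "tw_PnM n m (pure_tensor R P K p k) = pure_tensor R (tensor R P N) M (pure_tensor R P N p n) (actKM m k)"
    "tw_PmN m n (pure_tensor R P K p k) = pure_tensor R (tensor R P M) N (pure_tensor R P M p m) (actKN n k)"
    "tw_pNM p m (pure_tensor R N K n k) = pure_tensor R (tensor R P N) M (pure_tensor R P N p n) (actKM m k)"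
  unfolding tw_NM_def tw_PN_def tw_PM_def tw_PnM_def tw_PmN_def tw_pNM_def
  by ((rule tensor_map_pure, (intro linear_id actKM_linear actKN_linear linear_pure_left linear_pure_right mods assms)+)[1])+


lemma tw_closed:
  "m \<in> carrier M \<Longrightarrow> u \<in> carrier (tensor R N K) \<Longrightarrow> tw_NM m u \<in> carrier (tensor R N M)"
  "n \<in> carrier N \<Longrightarrow> t \<in> carrier (tensor R P K) \<Longrightarrow> tw_PN n t \<in> carrier (tensor R P N)"
  "m \<in> carrier M \<Longrightarrow> t \<in> carrier (tensor R P K) \<Longrightarrow> tw_PM m t \<in> carrier (tensor R P M)"
  "n \<in> carrier N \<Longrightarrow> m \<in> carrier M \<Longrightarrow> t \<in> carrier (tensor R P K) \<Longrightarrow> tw_PnM n m t \<in> carrier T"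
  "n \<in> carrier N \<Longrightarrow> m \<in> carrier M \<Longrightarrow> t \<in> carrier (tensor R P K) \<Longrightarrow>
    tw_PmN m n t \<in> carrier (tensor R (tensor R P M) N)"
  "p \<in> carrier P \<Longrightarrow> m \<in> carrier M \<Longrightarrow> u \<in> carrier (tensor R N K) \<Longrightarrow> tw_pNM p m u \<in> carrier T"
  by (rule linear_closed[OF tw_NM_linear[OF linear_id]] linear_closed[OF tw_PN_linear(1)[OF linear_id]]
      linear_closed[OF tw_PM_linear[OF linear_id]] linear_closed[OF tw_PnM_linear(1)[OF linear_id]]
      linear_closed[OF tw_PmN_linear[OF linear_id]] linear_closed[OF tw_pNM_linear(1)[OF linear_id]]; assumption)+

definition act_NK where "act_NK u g = tensor_act R N K actN cact u g"

lemma act_NK_bilinear: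
  assumes "g \<in> carrier G"
  shows "(\<lambda>n k. pure_tensor R N K n (cact k g) \<oplus>\<^bsub>tensor R N K\<^esub> pure_tensor R N K (actN n g) k)
    \<in> bilinear_maps R N K (tensor R N K)"
  by (intro bilinear_mapsI linear_plus linear_pure_left linear_pure_right linear_id mods assms
      bilinear_left[OF repN(5)] bilinear_left[OF repN(6)]
      linear_closed[OF bilinear_left[OF repN(5)]] linear_closed[OF bilinear_left[OF repN(6)]])

lemma act_NK_linear:
  "g \<in> carrier G \<Longrightarrow> (\<lambda>u. act_NK u g) \<in> linear_maps R (tensor R N K) (tensor R N K)"
  "u \<in> carrier (tensor R N K) \<Longrightarrow> (\<lambda>g. act_NK u g) \<in> linear_maps R G (tensor R N K)"
  unfolding act_NK_def tensor_act_def
   apply (intro tensor_lift_linear act_NK_bilinear mods; assumption)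
  apply (intro tensor_lift_linear_in_parameter act_NK_bilinear linear_plus linear_pure_left linear_pure_right mods
      bilinear_right[OF repN(5)] bilinear_right[OF repN(6)]; assumption)
  done

lemma act_NK_pure:
  "g \<in> carrier G \<Longrightarrow> n \<in> carrier N \<Longrightarrow> k \<in> carrier K \<Longrightarrow> act_NK (pure_tensor R N K n k) g =
    pure_tensor R N K n (cact k g) \<oplus>\<^bsub>tensor R N K\<^esub> pure_tensor R N K (actN n g) k"
  unfolding act_NK_def tensor_act_def
  by (subst tensor_lift_pure[OF mods(4) mods(1) mods(6) act_NK_bilinear]) (simp_all add: mods)

text \<open>The terms that involve both coactions, as a function of \<open>t\<close> and \<open>u\<close> standing for \<open>\<delta> p\<close> and \<open>\<delta> n\<close>:
on the left-hand side of the Yang-Baxter equation they arise as a linear map in \<open>u\<close> for fixed \<open>t\<close>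
(\<open>double_by_N\<close>), on the right-hand side as a linear map in \<open>t\<close> for fixed \<open>u\<close> (\<open>double_by_P\<close>).\<close>

definition double_by_N where "double_by_N m t u = tensor_lift R N K T (\<lambda>n k.
  pure_tensor R (tensor R P N) M (tw_PN n t) (actKM m k) \<oplus>\<^bsub>T\<^esub> tw_PnM n (actKM m k) t) u"

definition double_by_P where "double_by_P m u t = tensor_lift R P K T (\<lambda>p k.
  tw_pNM p (actKM m k) u \<oplus>\<^bsub>T\<^esub> tw_pNM p m (act_NK u (\<pi> k))) t"

lemma double_by_N_bilinear:
  assumes "m \<in> carrier M" "t \<in> carrier (tensor R P K)"
  shows "(\<lambda>n k. pure_tensor R (tensor R P N) M (tw_PN n t) (actKM m k) \<oplus>\<^bsub>T\<^esub> tw_PnM n (actKM m k) t) \<in> bilinear_maps R N K T"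
  by (intro bilinear_mapsI linear_plus linear_pure_left linear_pure_right linear_id mods assms
      tw_PN_linear tw_PnM_linear actKM_linear actKM_closed tw_closed)

lemma double_by_P_bilinear:
  assumes "m \<in> carrier M" "u \<in> carrier (tensor R N K)"
  shows "(\<lambda>p k. tw_pNM p (actKM m k) u \<oplus>\<^bsub>T\<^esub> tw_pNM p m (act_NK u (\<pi> k))) \<in> bilinear_maps R P K T"
  by (intro bilinear_mapsI linear_plus linear_id mods assms tw_pNM_linear actKM_linear actKM_closed tw_closed
      linear_comp[OF repM(4) act_NK_linear(2)] linear_closed[OF act_NK_linear(1)] linear_closed[OF repM(4)])

lemma double_by_N_linear:
  assumes "m \<in> carrier M" "t \<in> carrier (tensor R P K)"
  shows "double_by_N m t \<in> linear_maps R (tensor R N K) T"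
  unfolding double_by_N_def[abs_def] by (intro tensor_lift_linear double_by_N_bilinear mods assms)

lemma double_by_N_linear_coeff:
  assumes "m \<in> carrier M" "u \<in> carrier (tensor R N K)"
  shows "(\<lambda>t. double_by_N m t u) \<in> linear_maps R (tensor R P K) T"
  unfolding double_by_N_def by (intro tensor_lift_linear_in_parameter double_by_N_bilinear mods assms
     linear_plus linear_pure_left tw_PN_linear tw_PnM_linear linear_id actKM_closed)

lemma double_by_P_linear:
  assumes "m \<in> carrier M" "u \<in> carrier (tensor R N K)"
  shows "double_by_P m u \<in> linear_maps R (tensor R P K) T"
  unfolding double_by_P_def[abs_def] by (intro tensor_lift_linear double_by_P_bilinear mods assms)

lemma double_by_P_linear_coeff:
  assumes "m \<in> carrier M" "t \<in> carrier (tensor R P K)"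
  shows "(\<lambda>u. double_by_P m u t) \<in> linear_maps R (tensor R N K) T"
  unfolding double_by_P_def by (intro tensor_lift_linear_in_parameter double_by_P_bilinear mods assms
     linear_plus tw_pNM_linear linear_id actKM_closed act_NK_linear linear_closed[OF repM(4)])

text \<open>Both sides are bilinear in \<open>t\<close> and \<open>u\<close>, so let \<open>t = p \<otimes> l\<close> and \<open>u = n \<otimes> k\<close>. Then the left side is
\<open>p \<otimes> n * l \<otimes> m * k + p \<otimes> n \<otimes> (m * k) * l\<close> and the right side
\<open>p \<otimes> n \<otimes> (m * l) * k + p \<otimes> n \<otimes> m * (k \<cdot> \<pi> l) + p \<otimes> n * l \<otimes> m * k\<close>, and
\<open>m * (k \<cdot> \<pi> l) = (m * k) * l - (m * l) * k\<close>.\<close>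

lemma double_by_N_eq_double_by_P:
  assumes m: "m \<in> carrier M" and t: "t \<in> carrier (tensor R P K)" and u: "u \<in> carrier (tensor R N K)"
  shows "double_by_N m t u = double_by_P m u t"
proof (rule tensor_ext[OF mods(4,1) double_by_N_linear[OF m t] double_by_P_linear_coeff[OF m t] _ u])
  fix n k assume n: "n \<in> carrier N" and k: "k \<in> carrier K"
  have nk: "pure_tensor R N K n k \<in> carrier (tensor R N K)"
    by (intro pure_tensor_closed mods n k)
  show "double_by_N m t (pure_tensor R N K n k) = double_by_P m (pure_tensor R N K n k) t"
  proof (rule tensor_ext[OF mods(5,1) double_by_N_linear_coeff[OF m nk] double_by_P_linear[OF m nk] _ t])
    fix p l assume p: "p \<in> carrier P" and l: "l \<in> carrier K"
    interpret T: module R T by (intro mods)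
    interpret M: module R M by (rule mods)
    have pl: "pure_tensor R P K p l \<in> carrier (tensor R P K)"
      by (intro pure_tensor_closed mods p l)
    have \<pi>l: "\<pi> l \<in> carrier G" by (rule linear_closed[OF repM(4) l])
    have kl: "cact k (\<pi> l) \<in> carrier K"
      by (rule linear_closed[OF bilinear_left[OF repM(5) \<pi>l] k])
    have actN_eq: "actN n (\<pi> l) = actKN n l" by (simp add: actKN_def)
    define y where "y x = pure_tensor R (tensor R P N) M (pure_tensor R P N p n) x" for x
    have y: "y \<in> linear_maps R M T"
      unfolding y_def[abs_def]
      by (intro linear_pure_right linear_id mods pure_tensor_closed p n)
    have "double_by_N m (pure_tensor R P K p l) (pure_tensor R N K n k) =
        pure_tensor R (tensor R P N) M (pure_tensor R P N p (actKN n l)) (actKM m k) \<oplus>\<^bsub>T\<^esub> y (actKM (actKM m k) l)"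
      unfolding double_by_N_def y_def
      by (simp add: tensor_lift_pure[OF mods(4,1) _ double_by_N_bilinear[OF m pl] n k] tw_pure tw_pure(2)[OF m n p l] m n p k l actKM_closed mods)
    also have "\<dots> = y (actKM (actKM m l) k) \<oplus>\<^bsub>T\<^esub> (y (actKM (actKM m k) l \<ominus>\<^bsub>M\<^esub> actKM (actKM m l) k) \<oplus>\<^bsub>T\<^esub>
        pure_tensor R (tensor R P N) M (pure_tensor R P N p (actKN n l)) (actKM m k))"
    proof -
      have 1: "y (actKM (actKM m k) l) \<in> carrier T" "y (actKM (actKM m l) k) \<in> carrier T"
        by (intro linear_closed[OF y] actKM_closed m k l)+
      have 2: "pure_tensor R (tensor R P N) M (pure_tensor R P N p (actKN n l)) (actKM m k) \<in> carrier T"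
        by (intro pure_tensor_closed mods actKM_closed actKN_closed m n p k l)
      have "y (actKM (actKM m k) l \<ominus>\<^bsub>M\<^esub> actKM (actKM m l) k) = y (actKM (actKM m k) l) \<ominus>\<^bsub>T\<^esub> y (actKM (actKM m l) k)"
        by (intro linear_minus[OF y] mods actKM_closed m k l)
      with 1 2 show ?thesis
        by (simp add: a_minus_def T.a_ac T.M.r_neg2)
    qed
    also have "actKM (actKM m k) l \<ominus>\<^bsub>M\<^esub> actKM (actKM m l) k = actKM m (cact k (\<pi> l))"
      unfolding actKM_def by (rule repM(11)[OF m k l, symmetric])
    also have "y (actKM (actKM m l) k) \<oplus>\<^bsub>T\<^esub> (y (actKM m (cact k (\<pi> l))) \<oplus>\<^bsub>T\<^esub>
        pure_tensor R (tensor R P N) M (pure_tensor R P N p (actKN n l)) (actKM m k)) =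
        double_by_P m (pure_tensor R N K n k) (pure_tensor R P K p l)"
      unfolding double_by_P_def y_def
      by (simp add: tensor_lift_pure[OF mods(5,1) _ double_by_P_bilinear[OF m nk] p l] act_NK_pure[OF \<pi>l n k] actN_eq
          linear_add[OF tw_pNM_linear(1)[OF linear_id p m]] pure_tensor_closed
          tw_pure m n p k l kl actKM_closed actKN_closed mods)
    finally show "double_by_N m (pure_tensor R P K p l) (pure_tensor R N K n k) =
        double_by_P m (pure_tensor R N K n k) (pure_tensor R P K p l)" .
  qed
qed


abbreviation "\<sigma>MN \<equiv> leibniz_braiding R K \<pi> M actM N \<delta>N"
abbreviation "\<sigma>MP \<equiv> leibniz_braiding R K \<pi> M actM P \<delta>P"
abbreviation "\<sigma>NP \<equiv> leibniz_braiding R K \<pi> N actN P \<delta>P"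

lemmas \<sigma>MN = leibniz_braiding[where act = actM and \<pi> = \<pi>, OF repM(3) repN(3) repM(1) repM(10) repN(7)]
lemmas \<sigma>MP = leibniz_braiding[where act = actM and \<pi> = \<pi>, OF repM(3) repP(3) repM(1) repM(10) repP(7)]
lemmas \<sigma>NP = leibniz_braiding[where act = actN and \<pi> = \<pi>, OF repN(3) repP(3) repM(1) repN(10) repP(7)]

lemma \<delta>N_closed: "n \<in> carrier N \<Longrightarrow> \<delta>N n \<in> carrier (tensor R N K)"
  by (rule linear_closed[OF repN(7)])
lemma \<delta>P_closed: "p \<in> carrier P \<Longrightarrow> \<delta>P p \<in> carrier (tensor R P K)"
  by (rule linear_closed[OF repP(7)])

text \<open>The last two crossings of the left-hand side and the first two of the right-hand side. In both, \<open>P\<close> moves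
across two factors, so \<open>braiding_past_two\<close> evaluates them.\<close>

definition lhs_rest where "lhs_rest x = tensor_left R N P M \<sigma>NP (tensor_right R N M P \<sigma>MP x)"
definition rhs_first where "rhs_first x = tensor_left R M P N \<sigma>MP (tensor_right R M N P \<sigma>NP x)"

lemma lhs_rest_linear: "lhs_rest \<in> linear_maps R (tensor R (tensor R N M) P) T"
  unfolding lhs_rest_def[abs_def]
  by (rule linear_comp[OF tensor_right_linear tensor_left_linear]; intro \<sigma>MP \<sigma>NP mods)

lemma rhs_first_linear: "rhs_first \<in> linear_maps R (tensor R (tensor R M N) P) (tensor R (tensor R P M) N)"
  unfolding rhs_first_def[abs_def]
  by (rule linear_comp[OF tensor_right_linear tensor_left_linear]; intro \<sigma>MP \<sigma>NP mods)

lemma lhs_rest_pure: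
  assumes "n \<in> carrier N" "m \<in> carrier M" "p \<in> carrier P"
  shows "lhs_rest (pure_tensor R (tensor R N M) P (pure_tensor R N M n m) p) =
    pure_tensor R (tensor R P N) M (pure_tensor R P N p n) m \<oplus>\<^bsub>T\<^esub>
    pure_tensor R (tensor R P N) M (tw_PN n (\<delta>P p)) m \<oplus>\<^bsub>T\<^esub> tw_PnM n m (\<delta>P p)"
  unfolding lhs_rest_def tw_PN_def tw_PnM_def actKM_def[abs_def] actKN_def[abs_def]
  by (rule braiding_past_two[where actM = actM and actN = actN and \<pi> = \<pi>,
        OF mods(3,4,5,1) repM(10) repN(10) repP(7,8) assms])

lemma rhs_first_pure:
  assumes "n \<in> carrier N" "m \<in> carrier M" "p \<in> carrier P"
  shows "rhs_first (pure_tensor R (tensor R M N) P (pure_tensor R M N m n) p) =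
    pure_tensor R (tensor R P M) N (pure_tensor R P M p m) n \<oplus>\<^bsub>tensor R (tensor R P M) N\<^esub>
    pure_tensor R (tensor R P M) N (tw_PM m (\<delta>P p)) n \<oplus>\<^bsub>tensor R (tensor R P M) N\<^esub> tw_PmN m n (\<delta>P p)"
  unfolding rhs_first_def tw_PM_def tw_PmN_def actKM_def[abs_def] actKN_def[abs_def]
  by (rule braiding_past_two[where actM = actN and actN = actM and \<pi> = \<pi>,
        OF mods(4,3,5,1) repN(10) repM(10) repP(7,8) assms(2,1,3)])

lemma assoc_inv_tw_NM:
  assumes p: "p \<in> carrier P" and m: "m \<in> carrier M" and u: "u \<in> carrier (tensor R N K)"
  shows "tensor_assoc_inv R P N M (pure_tensor R P (tensor R N M) p (tw_NM m u)) = tw_pNM p m u"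
proof (rule tensor_ext[OF mods(4,1) _ tw_pNM_linear(1)[OF linear_id p m] _ u])
  show "(\<lambda>u. tensor_assoc_inv R P N M (pure_tensor R P (tensor R N M) p (tw_NM m u)))
      \<in> linear_maps R (tensor R N K) T"
    by (rule linear_comp[OF linear_pure_right tensor_assoc_inv_linear];
        intro tw_NM_linear linear_id mods m p)
qed (simp add: tw_pure[OF m _ p] tensor_assoc_inv_pure mods p m actKM_closed)

definition rhs_last where "rhs_last x = tensor_right R P M N \<sigma>MN x"

lemma rhs_last_linear: "rhs_last \<in> linear_maps R (tensor R (tensor R P M) N) T"
  unfolding rhs_last_def[abs_def] by (intro tensor_right_linear \<sigma>MN mods)

lemma rhs_last_pure:
  assumes p: "p \<in> carrier P" and m: "m \<in> carrier M" and n: "n \<in> carrier N"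
  shows "rhs_last (pure_tensor R (tensor R P M) N (pure_tensor R P M p m) n) =
    pure_tensor R (tensor R P N) M (pure_tensor R P N p n) m \<oplus>\<^bsub>T\<^esub> tw_pNM p m (\<delta>N n)"
proof -
  let ?h = "\<lambda>x. tensor_assoc_inv R P N M (pure_tensor R P (tensor R N M) p x)"
  have h: "?h \<in> linear_maps R (tensor R N M) T"
    by (rule linear_comp[OF linear_pure_right tensor_assoc_inv_linear]; intro linear_id mods p)
  have "rhs_last (pure_tensor R (tensor R P M) N (pure_tensor R P M p m) n) =
      ?h (pure_tensor R N M n m \<oplus>\<^bsub>tensor R N M\<^esub> tw_NM m (\<delta>N n))"
    unfolding rhs_last_def tw_NM_def actKM_def[abs_def]
    by (simp add: tensor_right_pure[OF \<sigma>MN(1)] \<sigma>MN(2) mods p m n)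
  also have "\<dots> = ?h (pure_tensor R N M n m) \<oplus>\<^bsub>T\<^esub> ?h (tw_NM m (\<delta>N n))"
    by (intro linear_add[OF h] pure_tensor_closed tw_closed \<delta>N_closed mods m n)
  finally show ?thesis
    by (simp add: assoc_inv_tw_NM p m n \<delta>N_closed tensor_assoc_inv_pure mods)
qed

text \<open>The contribution of the second summand of \<open>\<sigma> (m \<otimes> n)\<close>, for a general tensor \<open>u\<close> in place of \<open>\<delta> n\<close>.\<close>

lemma lhs_rest_tw_NM:
  assumes p: "p \<in> carrier P" and m: "m \<in> carrier M" and u: "u \<in> carrier (tensor R N K)"
  shows "lhs_rest (pure_tensor R (tensor R N M) P (tw_NM m u) p) = tw_pNM p m u \<oplus>\<^bsub>T\<^esub> double_by_N m (\<delta>P p) u"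
proof (rule tensor_ext[OF mods(4,1) _ _ _ u])
  interpret T: module R T by (intro mods)
  have \<delta>p: "\<delta>P p \<in> carrier (tensor R P K)" by (rule \<delta>P_closed[OF p])
  show "(\<lambda>u. lhs_rest (pure_tensor R (tensor R N M) P (tw_NM m u) p)) \<in> linear_maps R (tensor R N K) T"
    by (rule linear_comp[OF linear_pure_left lhs_rest_linear]; intro tw_NM_linear linear_id mods m p)
  show "(\<lambda>u. tw_pNM p m u \<oplus>\<^bsub>T\<^esub> double_by_N m (\<delta>P p) u) \<in> linear_maps R (tensor R N K) T"
    by (intro linear_plus tw_pNM_linear linear_id double_by_N_linear mods p m \<delta>p)
  fix n k assume n: "n \<in> carrier N" and k: "k \<in> carrier K"
  have "tw_PN n (\<delta>P p) \<in> carrier (tensor R P N)" "tw_PnM n (actKM m k) (\<delta>P p) \<in> carrier T"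
    by (intro tw_closed \<delta>p n k m actKM_closed)+
  then show "lhs_rest (pure_tensor R (tensor R N M) P (tw_NM m (pure_tensor R N K n k)) p) =
      tw_pNM p m (pure_tensor R N K n k) \<oplus>\<^bsub>T\<^esub> double_by_N m (\<delta>P p) (pure_tensor R N K n k)"
    unfolding double_by_N_def
    by (simp add: tw_pure[OF m n p k] lhs_rest_pure n m k p actKM_closed tensor_lift_pure[OF mods(4,1) _ double_by_N_bilinear[OF m \<delta>p] n k]
        mods T.a_assoc pure_tensor_closed)
qed

text \<open>The two terms in which the coaction of \<open>p\<close> was used, for a general tensor \<open>t\<close> in place of \<open>\<delta> p\<close>. Equivariance
of \<open>\<delta>\<close> enters here: the last crossing needs the coaction of \<open>n * k\<close>.\<close>

lemma rhs_last_tw: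
  assumes m: "m \<in> carrier M" and n: "n \<in> carrier N" and t: "t \<in> carrier (tensor R P K)"
  shows "rhs_last (pure_tensor R (tensor R P M) N (tw_PM m t) n) \<oplus>\<^bsub>T\<^esub> rhs_last (tw_PmN m n t) =
    tw_PnM n m t \<oplus>\<^bsub>T\<^esub> pure_tensor R (tensor R P N) M (tw_PN n t) m \<oplus>\<^bsub>T\<^esub> double_by_P m (\<delta>N n) t"
proof (rule tensor_ext[OF mods(5,1) _ _ _ t])
  interpret T: module R T by (intro mods)
  have \<delta>n: "\<delta>N n \<in> carrier (tensor R N K)" by (rule \<delta>N_closed[OF n])
  show "(\<lambda>t. rhs_last (pure_tensor R (tensor R P M) N (tw_PM m t) n) \<oplus>\<^bsub>T\<^esub> rhs_last (tw_PmN m n t))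
      \<in> linear_maps R (tensor R P K) T"
    by (intro linear_plus linear_comp[OF _ rhs_last_linear] linear_pure_left tw_PM_linear tw_PmN_linear linear_id mods m n)
  show "(\<lambda>t. tw_PnM n m t \<oplus>\<^bsub>T\<^esub> pure_tensor R (tensor R P N) M (tw_PN n t) m \<oplus>\<^bsub>T\<^esub> double_by_P m (\<delta>N n) t)
      \<in> linear_maps R (tensor R P K) T"
    by (intro linear_plus linear_pure_left tw_PnM_linear tw_PN_linear double_by_P_linear linear_id mods m n \<delta>n)
  fix p k assume p: "p \<in> carrier P" and k: "k \<in> carrier K"
  have \<pi>k: "\<pi> k \<in> carrier G" by (rule linear_closed[OF repM(4) k])
  have \<delta>_act: "\<delta>N (actKN n k) = act_NK (\<delta>N n) (\<pi> k)"
    unfolding actKN_def act_NK_def by (rule repN(9)[OF n \<pi>k])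
  have "act_NK (\<delta>N n) (\<pi> k) \<in> carrier (tensor R N K)"
    by (rule linear_closed[OF act_NK_linear(1)[OF \<pi>k] \<delta>n])
  then have "tw_pNM p (actKM m k) (\<delta>N n) \<in> carrier T" "tw_pNM p m (act_NK (\<delta>N n) (\<pi> k)) \<in> carrier T"
    by (intro tw_closed p m k n \<delta>n actKM_closed; assumption)+
  moreover have "pure_tensor R (tensor R P N) M (pure_tensor R P N p n) (actKM m k) \<in> carrier T"
    "pure_tensor R (tensor R P N) M (pure_tensor R P N p (actKN n k)) m \<in> carrier T"
    by (intro pure_tensor_closed mods p n m k actKM_closed actKN_closed)+
  ultimately show "rhs_last (pure_tensor R (tensor R P M) N (tw_PM m (pure_tensor R P K p k)) n) \<oplus>\<^bsub>T\<^esub>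
      rhs_last (tw_PmN m n (pure_tensor R P K p k)) =
    tw_PnM n m (pure_tensor R P K p k) \<oplus>\<^bsub>T\<^esub>
      pure_tensor R (tensor R P N) M (tw_PN n (pure_tensor R P K p k)) m \<oplus>\<^bsub>T\<^esub>
      double_by_P m (\<delta>N n) (pure_tensor R P K p k)"
    unfolding double_by_P_def
    by (simp add: tw_pure[OF m n p k] rhs_last_pure n m k p actKM_closed actKN_closed \<delta>_act
        tensor_lift_pure[OF mods(5,1) _ double_by_P_bilinear[OF m \<delta>n] p k] mods T.a_ac)
qed

lemma yang_baxter_pure:
  assumes m: "m \<in> carrier M" and n: "n \<in> carrier N" and p: "p \<in> carrier P"
  defines "z \<equiv> pure_tensor R (tensor R M N) P (pure_tensor R M N m n) p"
  shows "lhs_rest (tensor_left R M N P \<sigma>MN z) = rhs_last (rhs_first z)"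
proof -
  interpret T: module R T by (intro mods)
  have \<delta>p: "\<delta>P p \<in> carrier (tensor R P K)" by (rule \<delta>P_closed[OF p])
  have \<delta>n: "\<delta>N n \<in> carrier (tensor R N K)" by (rule \<delta>N_closed[OF n])
  have pure_p: "(\<lambda>x. pure_tensor R (tensor R N M) P x p)
      \<in> linear_maps R (tensor R N M) (tensor R (tensor R N M) P)"
    by (intro linear_pure_left linear_id mods p)
  \<comment> \<open>The five summands to which both sides reduce. On the left they appear in the order
    1, 2, 3, 4, 5, on the right in the order 1, 4, 3, 2, 5.\<close>
  define w1 where "w1 = pure_tensor R (tensor R P N) M (pure_tensor R P N p n) m"
  define w2 where "w2 = pure_tensor R (tensor R P N) M (tw_PN n (\<delta>P p)) m"
  define w3 where "w3 = tw_PnM n m (\<delta>P p)"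
  define w4 where "w4 = tw_pNM p m (\<delta>N n)"
  define w5 where "w5 = double_by_N m (\<delta>P p) (\<delta>N n)"
  have w: "w1 \<in> carrier T" "w2 \<in> carrier T" "w3 \<in> carrier T" "w4 \<in> carrier T" "w5 \<in> carrier T"
    unfolding w1_def w2_def w3_def w4_def w5_def
    by (intro pure_tensor_closed tw_closed linear_closed[OF double_by_N_linear] mods m n p \<delta>p \<delta>n)+
  have "tensor_left R M N P \<sigma>MN z = pure_tensor R (tensor R N M) P
      (pure_tensor R N M n m \<oplus>\<^bsub>tensor R N M\<^esub> tw_NM m (\<delta>N n)) p"
    unfolding z_def tw_NM_def actKM_def[abs_def]
    by (simp add: tensor_left_pure[OF \<sigma>MN(1)] \<sigma>MN(2) mods pure_tensor_closed m n p)
  also have "\<dots> = pure_tensor R (tensor R N M) P (pure_tensor R N M n m) p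
      \<oplus>\<^bsub>tensor R (tensor R N M) P\<^esub> pure_tensor R (tensor R N M) P (tw_NM m (\<delta>N n)) p"
    by (intro linear_add[OF pure_p] pure_tensor_closed tw_closed mods m n \<delta>n)
  also have "lhs_rest \<dots> = lhs_rest (pure_tensor R (tensor R N M) P (pure_tensor R N M n m) p) \<oplus>\<^bsub>T\<^esub>
      lhs_rest (pure_tensor R (tensor R N M) P (tw_NM m (\<delta>N n)) p)"
    by (intro linear_add[OF lhs_rest_linear] pure_tensor_closed tw_closed mods m n p \<delta>n)
  also have "\<dots> = (w1 \<oplus>\<^bsub>T\<^esub> w2 \<oplus>\<^bsub>T\<^esub> w3) \<oplus>\<^bsub>T\<^esub> (w4 \<oplus>\<^bsub>T\<^esub> w5)"
    unfolding w1_def w2_def w3_def w4_def w5_def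
    by (simp only: lhs_rest_pure[OF n m p] lhs_rest_tw_NM[OF p m \<delta>n])
  also have "\<dots> = (w1 \<oplus>\<^bsub>T\<^esub> w4) \<oplus>\<^bsub>T\<^esub> (w3 \<oplus>\<^bsub>T\<^esub> w2 \<oplus>\<^bsub>T\<^esub> w5)"
    using w by (simp add: T.a_ac)
  also have "\<dots> = rhs_last (pure_tensor R (tensor R P M) N (pure_tensor R P M p m) n) \<oplus>\<^bsub>T\<^esub>
      (rhs_last (pure_tensor R (tensor R P M) N (tw_PM m (\<delta>P p)) n) \<oplus>\<^bsub>T\<^esub> rhs_last (tw_PmN m n (\<delta>P p)))"
    unfolding w1_def w2_def w3_def w4_def w5_def double_by_N_eq_double_by_P[OF m \<delta>p \<delta>n]
    by (simp only: rhs_last_pure[OF p m n] rhs_last_tw[OF m n \<delta>p])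
  also have "\<dots> = rhs_last (rhs_first z)"
  proof -
    interpret S: module R "tensor R (tensor R P M) N" by (intro mods)
    have "pure_tensor R (tensor R P M) N (pure_tensor R P M p m) n \<in> carrier (tensor R (tensor R P M) N)"
      "pure_tensor R (tensor R P M) N (tw_PM m (\<delta>P p)) n \<in> carrier (tensor R (tensor R P M) N)"
      "tw_PmN m n (\<delta>P p) \<in> carrier (tensor R (tensor R P M) N)"
      by (intro pure_tensor_closed tw_closed mods m n p \<delta>p)+
    then show ?thesis
      unfolding z_def rhs_first_pure[OF n m p]
      using linear_closed[OF rhs_last_linear]
      by (simp add: linear_add[OF rhs_last_linear] T.a_assoc)
  qed
  finally show ?thesis .
qed

lemma yang_baxter:
  assumes x: "x \<in> carrier (tensor R (tensor R M N) P)"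
  shows "lhs_rest (tensor_left R M N P \<sigma>MN x) = rhs_last (rhs_first x)"
proof (rule tensor_ext[OF _ _ _ _ _ x])
  have L: "(\<lambda>x. lhs_rest (tensor_left R M N P \<sigma>MN x)) \<in> linear_maps R (tensor R (tensor R M N) P) T"
    by (rule linear_comp[OF tensor_left_linear lhs_rest_linear]; intro \<sigma>MN mods)
  have Rt: "(\<lambda>x. rhs_last (rhs_first x)) \<in> linear_maps R (tensor R (tensor R M N) P) T"
    by (rule linear_comp[OF rhs_first_linear rhs_last_linear])
  show "(\<lambda>x. lhs_rest (tensor_left R M N P \<sigma>MN x)) \<in> linear_maps R (tensor R (tensor R M N) P) T"
    "(\<lambda>x. rhs_last (rhs_first x)) \<in> linear_maps R (tensor R (tensor R M N) P) T" by (rule L Rt)+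
  show "module R (tensor R M N)" "module R P" by (intro mods)+
  fix y p assume y: "y \<in> carrier (tensor R M N)" and p: "p \<in> carrier P"
  have pure_p: "(\<lambda>y. pure_tensor R (tensor R M N) P y p)
      \<in> linear_maps R (tensor R M N) (tensor R (tensor R M N) P)"
    by (intro linear_pure_left linear_id mods p)
  show "lhs_rest (tensor_left R M N P \<sigma>MN (pure_tensor R (tensor R M N) P y p)) =
      rhs_last (rhs_first (pure_tensor R (tensor R M N) P y p))"
    by (rule tensor_ext[OF mods(3,4) linear_comp[OF pure_p L] linear_comp[OF pure_p Rt] _ y])
      (rule yang_baxter_pure[OF _ _ p])
qed

end

theorem theorem3:
  fixes R :: "('k, 'z) ring_scheme"
    and K :: "('k, 'a, 'x) leibniz_scheme"
    and G :: "('k, 'g, 'y) leibniz_scheme"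
    and \<pi> :: "'a \<Rightarrow> 'g"
    and cact :: "'a \<Rightarrow> 'g \<Rightarrow> 'a"
    and r :: nat
    and M :: "nat \<Rightarrow> ('k, 'm, 'w) module_scheme"
    and act :: "nat \<Rightarrow> 'm \<Rightarrow> 'g \<Rightarrow> 'm"
    and \<delta> :: "nat \<Rightarrow> 'm \<Rightarrow> ('m \<times> 'a \<Rightarrow> 'k) set"
  assumes "field R"
    and "leibniz_crossed_module R K G \<pi> cact"
    and "\<And>i. i \<in> {1..r} \<Longrightarrow> crossed_module_representation R K G \<pi> cact (M i) (act i) (\<delta> i)"
  shows "braided_system R r M (\<lambda>i j. leibniz_braiding R K \<pi> (M i) (act i) (M j) (\<delta> j)) \<and>
    (\<forall>i\<in>{1..r}. \<forall>j\<in>{i..r}. \<forall>m\<in>carrier (M i). \<forall>n\<in>carrier (M j).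
       \<forall>(l::nat) n0 n1. n0 \<in> {..<l} \<rightarrow> carrier (M j) \<and> n1 \<in> {..<l} \<rightarrow> carrier K \<and>
         \<delta> j n = (\<Oplus>\<^bsub>tensor R (M j) K\<^esub>s\<in>{..<l}. pure_tensor R (M j) K (n0 s) (n1 s)) \<longrightarrow>
         leibniz_braiding R K \<pi> (M i) (act i) (M j) (\<delta> j) (pure_tensor R (M i) (M j) m n) =
           pure_tensor R (M j) (M i) n m \<oplus>\<^bsub>tensor R (M j) (M i)\<^esub>
           (\<Oplus>\<^bsub>tensor R (M j) (M i)\<^esub>s\<in>{..<l}.
              pure_tensor R (M j) (M i) (n0 s) (act i m (\<pi> (n1 s)))))"
proof (intro conjI ballI allI impI)
  note rep = crossed_module_representationD[OF assms(3)]
  show "braided_system R r M (\<lambda>i j. leibniz_braiding R K \<pi> (M i) (act i) (M j) (\<delta> j))"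
  proof (intro braided_system.intro braided_system_axioms.intro)
    show "field R" by (rule assms(1))
    show "module R (M i)" if "i \<in> {1..r}" for i by (rule rep(3)[OF that])
    show "leibniz_braiding R K \<pi> (M i) (act i) (M j) (\<delta> j) \<in>
        linear_maps R (tensor R (M i) (M j)) (tensor R (M j) (M i))"
      if "i \<in> {1..r}" "j \<in> {1..r}" "i \<le> j" for i j
      by (intro leibniz_braiding_linear rep(3)[OF that(1)] rep(3)[OF that(2)] rep(1)[OF that(1)]
          rep(10)[OF that(1)] rep(7)[OF that(2)])
    fix i j k x
    assume ijk: "i \<in> {1..r}" "j \<in> {1..r}" "k \<in> {1..r}" "i \<le> j" "j \<le> k"
      and x: "x \<in> carrier (tensor R (tensor R (M i) (M j)) (M k))"
    interpret representation_triple R K G \<pi> cact "M i" "act i" "\<delta> i" "M j" "act j" "\<delta> j" "M k" "act k" "\<delta> k"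
      by (rule representation_triple.intro[OF assms(3)[OF ijk(1)] assms(3)[OF ijk(2)] assms(3)[OF ijk(3)]])
    show "(tensor_left R (M j) (M k) (M i) (leibniz_braiding R K \<pi> (M j) (act j) (M k) (\<delta> k)) \<circ>
         tensor_right R (M j) (M i) (M k) (leibniz_braiding R K \<pi> (M i) (act i) (M k) (\<delta> k)) \<circ>
         tensor_left R (M i) (M j) (M k) (leibniz_braiding R K \<pi> (M i) (act i) (M j) (\<delta> j))) x =
        (tensor_right R (M k) (M i) (M j) (leibniz_braiding R K \<pi> (M i) (act i) (M j) (\<delta> j)) \<circ>
         tensor_left R (M i) (M k) (M j) (leibniz_braiding R K \<pi> (M i) (act i) (M k) (\<delta> k)) \<circ>
         tensor_right R (M i) (M j) (M k) (leibniz_braiding R K \<pi> (M j) (act j) (M k) (\<delta> k))) x"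
      using yang_baxter[OF x] by (simp add: lhs_rest_def rhs_first_def rhs_last_def)
  qed
next
  note rep = crossed_module_representationD[OF assms(3)]
  fix i j m n and l :: nat and n0 n1
  assume i: "i \<in> {1..r}" and j: "j \<in> {i..r}" and m: "m \<in> carrier (M i)" and n: "n \<in> carrier (M j)"
    and *: "n0 \<in> {..<l} \<rightarrow> carrier (M j) \<and> n1 \<in> {..<l} \<rightarrow> carrier K \<and>
      \<delta> j n = (\<Oplus>\<^bsub>tensor R (M j) K\<^esub>s\<in>{..<l}. pure_tensor R (M j) K (n0 s) (n1 s))"
  have j': "j \<in> {1..r}" using i j by auto
  show "leibniz_braiding R K \<pi> (M i) (act i) (M j) (\<delta> j) (pure_tensor R (M i) (M j) m n) =
      pure_tensor R (M j) (M i) n m \<oplus>\<^bsub>tensor R (M j) (M i)\<^esub>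
      (\<Oplus>\<^bsub>tensor R (M j) (M i)\<^esub>s\<in>{..<l}. pure_tensor R (M j) (M i) (n0 s) (act i m (\<pi> (n1 s))))"
    using * by (intro leibniz_braiding_sweedler[where act = "act i" and \<pi> = \<pi>,
          OF rep(3)[OF i] rep(3)[OF j'] rep(1)[OF i]
          rep(10)[OF i] rep(7)[OF j'] m n]) auto
qed

end
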